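(* A poset $\mathcal L$ is a finitary geometric semilattice if and only if it is isomorphic to the poset of flats of a finitary semimatroid. Furthermore, each finitary geometric semilattice is (isomorphic to) the poset of flats of a simple finitary semimatroid which is unique up to isomorphism.
   Context: A finitary semimatroid is a triple $\mathcal S=(S,\mathcal C,\mathrm{rk})$ where $S$ is a (possibly infinite) set, $\mathcal C$ is a non-empty finite-dimensional simplicial complex on $S$ (a family of finite subsets of bounded cardinality, closed under taking subsets) with $\{x\}\in\mathcal C$ for all $x\in S$, and $\mathrm{rk}:\mathcal C\to\mathbb N=\{0,1,\dots\}$ is a bounded function such that: (R1) $0\le \mathrm{rk}(X)\le |X|$ for $X\in\mathcal C$; (R2) $X\subseteq Y$ in $\mathcal C$ implies $\mathrm{rk}(X)\le\mathrm{rk}(Y)$; (R3) if $X,Y,X\cup Y\in\mathcal C$ then $\mathrm{rk}(X)+\mathrm{rk}(Y)\ge \mathrm{rk}(X\cup Y)+\mathrm{rk}(X\cap Y)$; (CR1) if $X,Y\in\mathcal C$ and $\mathrm{rk}(X)=\mathrm{rk}(X\cap Y)$ then $X\cup Y\in\mathcal C$; (CR2) if $X,Y\in\mathcal C$ and $\mathrm{rk}(X)<\mathrm{rk}(Y)$ then $X\cup\{y\}\in\mathcal C$ for some $y\in Y\setminus X$. It is simple if $\mathrm{rk}(\{x\})=1$ for all $x\in S$ and $\mathrm{rk}(\{x,y\})=2$ for all $\{x,y\}\in\mathcal C$ with $x\ne y$. An isomorphism of semimatroids is a bijection of ground sets inducing a bijection of central sets (elements of $\mathcal C$) and preserving rank.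 The closure of $X\in\mathcal C$ is $\mathrm{cl}(X)=\{x\in S: X\cup\{x\}\in\mathcal C,\ \mathrm{rk}(X\cup\{x\})=\mathrm{rk}(X)\}$; a flat is $X\in\mathcal C$ with $\mathrm{cl}(X)=X$. The poset of flats is the set of all flats ordered by inclusion. Posets are chain-finite (every chain has finite length) and non-empty. A poset is ranked if there is $\mathrm{rk}:\mathcal P\to\mathbb N$ with $\mathrm{rk}(q)=\mathrm{rk}(p)+1$ whenever $q$ covers $p$, normalized by $\mathrm{rk}(\hat0)=0$ if there is a minimum $\hat0$. A meet-semilattice is a poset in which any two elements have a meet. Atoms are elements covering $\hat0$. A geometric lattice is a finite ranked lattice in which every element is a join of atoms and which is semimodular: $\mathrm{rk}(x\vee y)+\mathrm{rk}(x\wedge y)\le \mathrm{rk}(x)+\mathrm{rk}(y)$. A set $A$ of atoms is independent if the join $\vee A$ exists and $\mathrm{rk}(\vee A)=|A|$. A finitary geometric semilattice is a (chain-finite) ranked meet-semilattice $\mathcal L$ such that (G3) there is $N\in\mathbb N$ such that every (maximal) interval in $\mathcal L$ is a (finite) geometric lattice with at most $N$ atoms; (G4) for every independent set $A$ of atoms of $\mathcal L$ and every $x\in\mathcal L$ with $\mathrm{rk}(x)<\mathrm{rk}(\vee A)$ there is $a\in A$ with $a\not\le x$ such that $x\vee a$ exists. *)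

theory Defs
  imports "HOL-Algebra.Lattice"
begin

definition covers :: "('a, 'm) gorder_scheme \<Rightarrow> 'a \<Rightarrow> 'a \<Rightarrow> bool" where
  "covers P q p \<longleftrightarrow> p \<in> carrier P \<and> q \<in> carrier P \<and> p \<sqsubset>\<^bsub>P\<^esub> q \<and>
     \<not> (\<exists>z\<in>carrier P. p \<sqsubset>\<^bsub>P\<^esub> z \<and> z \<sqsubset>\<^bsub>P\<^esub> q)"

definition atoms :: "('a, 'm) gorder_scheme \<Rightarrow> 'a set" where
  "atoms P = {a. \<exists>z. least P z (carrier P) \<and> covers P a z}"

definition chain_finite :: "('a, 'm) gorder_scheme \<Rightarrow> bool" where
  "chain_finite P \<longleftrightarrow>
     (\<forall>K \<subseteq> carrier P. (\<forall>x\<in>K. \<forall>y\<in>K. x \<sqsubseteq>\<^bsub>P\<^esub> y \<or> y \<sqsubseteq>\<^bsub>P\<^esub> x) \<longrightarrow> finite K)"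

definition rank_function :: "('a, 'm) gorder_scheme \<Rightarrow> ('a \<Rightarrow> nat) \<Rightarrow> bool" where
  "rank_function P r \<longleftrightarrow>
     (\<forall>p\<in>carrier P. \<forall>q\<in>carrier P. covers P q p \<longrightarrow> r q = r p + 1) \<and>
     (\<forall>z. least P z (carrier P) \<longrightarrow> r z = 0)"

definition ranked :: "('a, 'm) gorder_scheme \<Rightarrow> bool" where
  "ranked P \<longleftrightarrow> (\<exists>r. rank_function P r)"

text \<open>On a chain-finite poset with a minimum, any two rank functions agree on the carrier, so
  the choice below is irrelevant there. It is only applied to such posets.\<close>

definition poset_rank :: "('a, 'm) gorder_scheme \<Rightarrow> 'a \<Rightarrow> nat" where
  "poset_rank P = (SOME r. rank_function P r)"

definition interval :: "('a, 'm) gorder_scheme \<Rightarrow> 'a \<Rightarrow> 'a \<Rightarrow> ('a, 'm) gorder_scheme" where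
  "interval P x y = P\<lparr>carrier := \<lbrace>x..y\<rbrace>\<^bsub>P\<^esub>\<rparr>"

definition poset_isomorphic :: "('a, 'm) gorder_scheme \<Rightarrow> ('b, 'n) gorder_scheme \<Rightarrow> bool" where
  "poset_isomorphic P Q \<longleftrightarrow> (\<exists>f. bij_betw f (carrier P) (carrier Q) \<and> order_emb P Q f)"

locale geometric_lattice = Lattice.lattice L for L (structure) +
  assumes nonempty: "carrier L \<noteq> {}"
    and finite_carrier: "finite (carrier L)"
    and ranked: "ranked L"
    and atomistic: "x \<in> carrier L \<Longrightarrow> \<exists>A \<subseteq> atoms L. is_lub L x A"
    and semimodular: "\<lbrakk>x \<in> carrier L; y \<in> carrier L\<rbrakk> \<Longrightarrow>
      poset_rank L (x \<squnion> y) + poset_rank L (x \<sqinter> y) \<le> poset_rank L x + poset_rank L y"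

definition independent :: "('a, 'm) gorder_scheme \<Rightarrow> 'a set \<Rightarrow> bool" where
  "independent L A \<longleftrightarrow>
     A \<subseteq> atoms L \<and> finite A \<and> (\<exists>z. is_lub L z A) \<and> poset_rank L (\<Squnion>\<^bsub>L\<^esub>A) = card A"

locale finitary_geometric_semilattice = lower_semilattice L for L (structure) +
  assumes nonempty: "carrier L \<noteq> {}"
    and chain_finite: "chain_finite L"
    and ranked: "ranked L"
    and G3: "\<exists>N. \<forall>x\<in>carrier L. \<forall>y\<in>carrier L. x \<sqsubseteq> y \<longrightarrow>
      geometric_lattice (interval L x y) \<and> card (atoms (interval L x y)) \<le> N"
    and G4: "\<lbrakk>independent L A; x \<in> carrier L; poset_rank L x < poset_rank L (\<Squnion>A)\<rbrakk> \<Longrightarrow>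
      \<exists>a\<in>A. \<not> a \<sqsubseteq> x \<and> (\<exists>z. is_lub L z {x, a})"

text \<open>Only the values of \<open>rk\<close> on central sets are meaningful.\<close>

record 'a semimatroid =
  ground :: "'a set"
  central :: "'a set set"
  rk :: "'a set \<Rightarrow> nat"

locale finitary_semimatroid =
  fixes M :: "'a semimatroid"
  assumes central_nonempty: "central M \<noteq> {}"
    and central_ground: "X \<in> central M \<Longrightarrow> X \<subseteq> ground M"
    and central_finite: "X \<in> central M \<Longrightarrow> finite X"
    and central_subset: "\<lbrakk>X \<in> central M; Y \<subseteq> X\<rbrakk> \<Longrightarrow> Y \<in> central M"
    and central_singleton: "x \<in> ground M \<Longrightarrow> {x} \<in> central M"
    and finite_dimensional: "\<exists>d. \<forall>X\<in>central M. card X \<le> d"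
    and rank_bounded: "\<exists>N. \<forall>X\<in>central M. rk M X \<le> N"
    and R1: "X \<in> central M \<Longrightarrow> rk M X \<le> card X"
    and R2: "\<lbrakk>X \<in> central M; Y \<in> central M; X \<subseteq> Y\<rbrakk> \<Longrightarrow> rk M X \<le> rk M Y"
    and R3: "\<lbrakk>X \<in> central M; Y \<in> central M; X \<union> Y \<in> central M\<rbrakk> \<Longrightarrow>
      rk M X + rk M Y \<ge> rk M (X \<union> Y) + rk M (X \<inter> Y)"
    and CR1: "\<lbrakk>X \<in> central M; Y \<in> central M; rk M X = rk M (X \<inter> Y)\<rbrakk> \<Longrightarrow> X \<union> Y \<in> central M"
    and CR2: "\<lbrakk>X \<in> central M; Y \<in> central M; rk M X < rk M Y\<rbrakk> \<Longrightarrow>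
      \<exists>y \<in> Y - X. X \<union> {y} \<in> central M"

locale simple_finitary_semimatroid = finitary_semimatroid +
  assumes rank_singleton: "x \<in> ground M \<Longrightarrow> rk M {x} = 1"
    and rank_pair: "\<lbrakk>{x, y} \<in> central M; x \<noteq> y\<rbrakk> \<Longrightarrow> rk M {x, y} = 2"

definition semimatroid_isomorphic :: "'a semimatroid \<Rightarrow> 'b semimatroid \<Rightarrow> bool" where
  "semimatroid_isomorphic M M' \<longleftrightarrow>
     (\<exists>f. bij_betw f (ground M) (ground M') \<and>
          bij_betw (\<lambda>X. f ` X) (central M) (central M') \<and>
          (\<forall>X\<in>central M. rk M' (f ` X) = rk M X))"

definition cl :: "'a semimatroid \<Rightarrow> 'a set \<Rightarrow> 'a set" where
  "cl M X = {x \<in> ground M. X \<union> {x} \<in> central M \<and> rk M (X \<union> {x}) = rk M X}"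

definition flats :: "'a semimatroid \<Rightarrow> 'a set set" where
  "flats M = {X \<in> central M. cl M X = X}"

definition poset_of_flats :: "'a semimatroid \<Rightarrow> 'a set gorder" where
  "poset_of_flats M = \<lparr>carrier = flats M, eq = (=), le = (\<subseteq>)\<rparr>"

end

theory Submission
  imports Defs
begin

text \<open>
  In the poset of flats of a semimatroid every order-theoretic notion is visible in the sets
  themselves: meets are intersections, an existing join \<open>F \<squnion> G\<close> is the closure of \<open>F \<union> G\<close>, passing
  to an upper cover means adding one element and closing, and hence the poset rank is the rank of the
  semimatroid. Axiom (R3) then is semimodularity of the intervals, and (G4) is axiom (CR2) applied to
  a set that contains one element from each atom of the given independent set.

  Conversely, the atoms of a finitary geometric semilattice \<open>L\<close> are the elements of a semimatroid:
  a set of atoms is central if it is bounded above in \<open>L\<close>, and its rank is the rank of its join.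
  Joins of bounded sets exist because the lower intervals are lattices, and semimodularity
  of these intervals gives (R3). For (CR1), a join of the same rank as a smaller join is equal to it.
  For (CR2), a bounded set \<open>Y\<close> of atoms contains an independent set with the same join, and (G4)
  applies to that set. Lower intervals are atomistic, so sending \<open>x\<close> to the set of atoms
  below \<open>x\<close> identifies \<open>L\<close> with the poset of flats (\<open>atom_labelling\<close>).

  Uniqueness holds because this construction recovers every simple semimatroid: there the atoms
  of the poset of flats are the singletons, and a set is central iff it lies in a flat,
  that is, iff the corresponding atoms have an upper bound. So a simple semimatroid \<open>M\<close> whose flats
  form the poset \<open>L\<close> is isomorphic to the semimatroid on the atoms of \<open>L\<close>, and the latter
  depends on \<open>L\<close> only (\<open>simple_isomorphic_atom_semimatroid\<close>).

  Both directions compare the rank that is chosen for a poset with one that is given explicitly. This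
  is legitimate since two rank functions differ by a constant along any finite interval
  (\<open>poset_rank_eqI\<close>).
\<close>

section \<open>Posets with finite intervals\<close>

lemma is_lub_iff:
  fixes L (structure)
  assumes "A \<subseteq> carrier L"
  shows "is_lub L s A \<longleftrightarrow> s \<in> carrier L \<and> (\<forall>a\<in>A. a \<sqsubseteq> s) \<and>
    (\<forall>u\<in>carrier L. (\<forall>a\<in>A. a \<sqsubseteq> u) \<longrightarrow> s \<sqsubseteq> u)"
proof -
  have "A \<inter> carrier L = A" using assms by auto
  then show ?thesis unfolding least_def Upper_def by auto
qed

lemma is_glb_iff:
  fixes L (structure)
  assumes "A \<subseteq> carrier L"
  shows "is_glb L s A \<longleftrightarrow> s \<in> carrier L \<and> (\<forall>a\<in>A. s \<sqsubseteq> a) \<and>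
    (\<forall>u\<in>carrier L. (\<forall>a\<in>A. u \<sqsubseteq> a) \<longrightarrow> u \<sqsubseteq> s)"
proof -
  have "A \<inter> carrier L = A" using assms by auto
  then show ?thesis unfolding greatest_def Lower_def by auto
qed

lemma carrier_interval [simp]: "carrier (interval L x y) = \<lbrace>x..y\<rbrace>\<^bsub>L\<^esub>"
  and le_interval [simp]: "le (interval L x y) = le L"
  and eq_interval [simp]: "eq (interval L x y) = eq L"
  by (simp_all add: interval_def)

context partial_order
begin

lemma sup_eqI: "is_lub L s A \<Longrightarrow> \<Squnion>A = s"
  unfolding sup_def by (rule some_equality) (auto intro: least_unique)

lemma inf_eqI: "is_glb L s A \<Longrightarrow> \<Sqinter>A = s"
  unfolding inf_def by (rule some_equality) (auto intro: greatest_unique)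

lemma mem_interval_iff: "z \<in> \<lbrace>x..y\<rbrace> \<longleftrightarrow> z \<in> carrier L \<and> x \<sqsubseteq> z \<and> z \<sqsubseteq> y"
  by (auto simp: at_least_at_most_def)

lemma covers_iff:
  "covers L q p \<longleftrightarrow> p \<in> carrier L \<and> q \<in> carrier L \<and> p \<sqsubseteq> q \<and> p \<noteq> q \<and>
     (\<forall>z\<in>carrier L. p \<sqsubseteq> z \<and> z \<sqsubseteq> q \<longrightarrow> z = p \<or> z = q)"
  unfolding covers_def lless_eq by auto

lemma partial_order_interval: "partial_order (interval L x y)"
proof -
  interpret I: weak_partial_order "interval L x y"
    unfolding interval_def
    by (rule weak_partial_order_subset) (auto intro: weak_partial_order_axioms simp: at_least_at_most_def)
  show ?thesis by unfold_locales (simp add: eq_is_equal)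
qed

lemma covers_interval_iff:
  assumes "x \<in> carrier L" "y \<in> carrier L"
  shows "covers (interval L x y) q p \<longleftrightarrow> covers L q p \<and> x \<sqsubseteq> p \<and> q \<sqsubseteq> y"
proof -
  interpret I: partial_order "interval L x y" by (rule partial_order_interval)
  show ?thesis
    unfolding I.covers_iff covers_iff carrier_interval le_interval Ball_def mem_interval_iff
    using assms le_trans by metis
qed

lemma least_interval_iff:
  assumes "x \<in> carrier L" "y \<in> carrier L" "x \<sqsubseteq> y"
  shows "least (interval L x y) z \<lbrace>x..y\<rbrace> \<longleftrightarrow> z = x"
  using assms unfolding least_def by (auto simp: mem_interval_iff)

lemma atoms_interval:
  assumes "x \<in> carrier L" "y \<in> carrier L" "x \<sqsubseteq> y"
  shows "atoms (interval L x y) = {a. covers L a x \<and> a \<sqsubseteq> y}"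
  using assms by (auto simp: atoms_def least_interval_iff covers_interval_iff)

lemma is_lub_interval_iff:
  assumes "A \<subseteq> \<lbrace>x..y\<rbrace>" "x \<in> carrier L" "y \<in> carrier L"
  shows "is_lub (interval L x y) s A \<longleftrightarrow> s \<in> \<lbrace>x..y\<rbrace> \<and> (\<forall>a\<in>A. a \<sqsubseteq> s) \<and>
    (\<forall>u\<in>\<lbrace>x..y\<rbrace>. (\<forall>a\<in>A. a \<sqsubseteq> u) \<longrightarrow> s \<sqsubseteq> u)"
  using assms by (subst is_lub_iff) auto

text \<open>
  Take an element of \<open>\<lbrace>x..y\<rbrace>\<close> strictly between \<open>x\<close> and \<open>y\<close>, if there is one, and continue below it.
  The intervals \<open>\<lbrace>x..z\<rbrace>\<close> shrink, so the search ends.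
\<close>

lemma exists_cover:
  assumes "x \<in> carrier L" "y \<in> carrier L" "x \<sqsubseteq> y" "x \<noteq> y" "finite \<lbrace>x..y\<rbrace>"
  shows "\<exists>z. covers L z x \<and> z \<sqsubseteq> y"
  using assms
proof (induction "card \<lbrace>x..y\<rbrace>" arbitrary: y rule: less_induct)
  case less
  show ?case
  proof (cases "covers L y x")
    case True
    then show ?thesis using less.prems by auto
  next
    case False
    then obtain z where z: "z \<in> carrier L" "x \<sqsubseteq> z" "z \<sqsubseteq> y" "z \<noteq> x" "z \<noteq> y"
      using less.prems unfolding covers_iff by blast
    have sub: "\<lbrace>x..z\<rbrace> \<subseteq> \<lbrace>x..y\<rbrace>" using z less.prems by (auto simp: mem_interval_iff intro: le_trans)
    have "y \<in> \<lbrace>x..y\<rbrace> - \<lbrace>x..z\<rbrace>" using z less.prems by (auto simp: mem_interval_iff)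
    then have "\<lbrace>x..z\<rbrace> \<subset> \<lbrace>x..y\<rbrace>" using sub by auto
    then have "card \<lbrace>x..z\<rbrace> < card \<lbrace>x..y\<rbrace>" "finite \<lbrace>x..z\<rbrace>"
      using less.prems(5) by (auto intro: psubset_card_mono finite_subset)
    then obtain w where w: "covers L w x" "w \<sqsubseteq> z"
      using less.hyps[of z] less.prems(1) z by auto
    then have "w \<sqsubseteq> y" using z less.prems by (meson covers_iff le_trans)
    then show ?thesis using w by auto
  qed
qed

text \<open>
  A finite interval is traversed from its top to its bottom by steps along covers. This is how
  a rank function, which is constrained on covers only, is controlled along the whole interval.
\<close>

lemma descending_cover_induct [consumes 4, case_names top cover]:
  assumes "x \<in> carrier L" "y \<in> carrier L" "x \<sqsubseteq> y" "finite \<lbrace>x..y\<rbrace>"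
    and top: "Q y"
    and cover: "\<And>p q. covers L q p \<Longrightarrow> x \<sqsubseteq> p \<Longrightarrow> q \<sqsubseteq> y \<Longrightarrow> Q q \<Longrightarrow> Q p"
  shows "Q x"
  using assms
proof (induction "card \<lbrace>x..y\<rbrace>" arbitrary: x rule: less_induct)
  case less
  show ?case
  proof (cases "x = y")
    case False
    then obtain z where z: "covers L z x" "z \<sqsubseteq> y"
      using exists_cover less.prems by blast
    then have zx: "z \<in> carrier L" "x \<sqsubseteq> z" "z \<noteq> x" by (auto simp: covers_iff)
    have sub: "\<lbrace>z..y\<rbrace> \<subseteq> \<lbrace>x..y\<rbrace>" using zx less.prems(1,2) by (auto simp: mem_interval_iff intro: le_trans)
    have "x \<in> \<lbrace>x..y\<rbrace> - \<lbrace>z..y\<rbrace>" using zx less.prems by (auto simp: mem_interval_iff)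
    then have psub: "\<lbrace>z..y\<rbrace> \<subset> \<lbrace>x..y\<rbrace>" using sub by auto
    have "Q z"
    proof (rule less.hyps)
      show "card \<lbrace>z..y\<rbrace> < card \<lbrace>x..y\<rbrace>" using psub less.prems(4) by (rule psubset_card_mono[rotated])
      show "finite \<lbrace>z..y\<rbrace>" using sub less.prems(4) by (rule finite_subset)
      show "Q p" if "covers L q p" "z \<sqsubseteq> p" "q \<sqsubseteq> y" "Q q" for p q
      proof (rule less.prems(6)[OF that(1) _ that(3,4)])
        show "x \<sqsubseteq> p" using that(1,2) zx less.prems(1) by (meson covers_iff le_trans)
      qed
    qed (use z zx less.prems in auto)
    then show ?thesis using less.prems(1,6) z by auto
  qed (use less.prems in auto)
qed

lemma rank_function_mono:
  assumes "rank_function L r" "x \<in> carrier L" "y \<in> carrier L" "x \<sqsubseteq> y" "finite \<lbrace>x..y\<rbrace>"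
  shows "r x \<le> r y"
  using assms(2-5)
proof (induction rule: descending_cover_induct)
  case (cover p q)
  have "r q = r p + 1" using assms(1) cover(1) unfolding rank_function_def covers_iff by auto
  then show ?case using cover by simp
qed simp

lemma rank_function_strict_mono:
  assumes "rank_function L r" "x \<in> carrier L" "y \<in> carrier L" "x \<sqsubseteq> y" "x \<noteq> y" "finite \<lbrace>x..y\<rbrace>"
  shows "r x < r y"
proof -
  obtain z where z: "covers L z x" "z \<sqsubseteq> y" using exists_cover assms by blast
  have zx: "z \<in> carrier L" "x \<sqsubseteq> z" using z by (auto simp: covers_iff)
  have "r z = r x + 1" using assms(1) z(1) unfolding rank_function_def covers_iff by auto
  moreover have "\<lbrace>z..y\<rbrace> \<subseteq> \<lbrace>x..y\<rbrace>" using zx assms(2,3) by (auto simp: mem_interval_iff intro: le_trans)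
  then have "r z \<le> r y"
    using assms zx z by (intro rank_function_mono) (auto intro: finite_subset)
  ultimately show ?thesis by simp
qed

text \<open>
  The difference of two rank functions does not change along a cover, and it vanishes at
  the minimum.
\<close>

lemma poset_rank_eqI:
  assumes r: "rank_function L r" and z: "least L z (carrier L)"
    and x: "x \<in> carrier L" and fin: "finite \<lbrace>z..x\<rbrace>"
  shows "poset_rank L x = r x"
proof -
  let ?r = "poset_rank L"
  have r': "rank_function L ?r" unfolding poset_rank_def by (rule someI[of _ r]) (rule r)
  have "z \<in> carrier L" "z \<sqsubseteq> x" using z x by (auto simp: least_def)
  note z' = this
  have "?r z + r x = r z + ?r x"
    using z'(1) x z'(2) fin
  proof (induction rule: descending_cover_induct)
    case (cover p q)
    then show ?case using r r' unfolding rank_function_def covers_iff by auto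
  qed simp
  then show ?thesis using r r' z unfolding rank_function_def by auto
qed

text \<open>
  The rank function of an interval is normalized at the bottom of the interval,
  so \<open>r x\<close> is subtracted. Monotonicity of \<open>r\<close> ensures that the subtraction on the
  natural numbers does not truncate.
\<close>

lemma rank_function_interval:
  assumes r: "rank_function L r" and xy: "x \<in> carrier L" "y \<in> carrier L" "x \<sqsubseteq> y" and fin: "finite \<lbrace>x..y\<rbrace>"
  shows "rank_function (interval L x y) (\<lambda>w. r w - r x)"
  unfolding rank_function_def
proof (intro conjI ballI allI impI)
  fix p q assume pq: "p \<in> carrier (interval L x y)" "q \<in> carrier (interval L x y)"
    and "covers (interval L x y) q p"
  then have c: "covers L q p" by (simp add: covers_interval_iff xy)
  have "r q = r p + 1" using r c unfolding rank_function_def covers_iff by auto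
  moreover have "\<lbrace>x..p\<rbrace> \<subseteq> \<lbrace>x..y\<rbrace>" using pq xy(2) by (auto simp: mem_interval_iff intro: le_trans)
  then have "r x \<le> r p"
    using pq r xy fin by (intro rank_function_mono) (auto simp: mem_interval_iff intro: finite_subset)
  ultimately show "r q - r x = r p - r x + 1" by simp
next
  fix z assume "least (interval L x y) z (carrier (interval L x y))"
  then show "r z - r x = 0" using xy by (simp add: least_interval_iff)
qed

lemma poset_rank_interval:
  assumes r: "rank_function L r" and xy: "x \<in> carrier L" "y \<in> carrier L" "x \<sqsubseteq> y"
    and fin: "finite \<lbrace>x..y\<rbrace>" and w: "w \<in> \<lbrace>x..y\<rbrace>"
  shows "poset_rank (interval L x y) w = r w - r x"
proof -
  interpret I: partial_order "interval L x y" by (rule partial_order_interval)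
  show ?thesis
  proof (rule I.poset_rank_eqI[OF rank_function_interval[OF r xy fin]])
    show "least (interval L x y) x (carrier (interval L x y))"
      using xy by (simp add: least_interval_iff)
    show "finite \<lbrace>x..w\<rbrace>\<^bsub>interval L x y\<^esub>"
      by (rule finite_subset[OF _ fin]) (auto simp: at_least_at_most_def interval_def)
  qed (use w in simp)
qed

end

section \<open>Closure in semimatroids\<close>

context finitary_semimatroid
begin

lemma empty_central: "{} \<in> central M"
  using central_nonempty central_subset by blast

lemma rank_empty: "rk M {} = 0"
  using R1[OF empty_central] by simp

lemma subset_cl: "X \<in> central M \<Longrightarrow> X \<subseteq> cl M X"
  using central_ground by (auto simp: cl_def insert_absorb)

text \<open>
  One element \<open>e\<close> of the closure is added at a time: (CR1) for \<open>X \<union> {e}\<close> and \<open>X \<union> Y\<close>, which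
  meet in \<open>X\<close>, shows that their union is central, and (R3) that its rank has not increased.
\<close>

lemma union_subset_cl:
  assumes X: "X \<in> central M" and "finite Y" "Y \<subseteq> cl M X"
  shows "X \<union> Y \<in> central M \<and> rk M (X \<union> Y) = rk M X"
  using assms(2,3)
proof (induction rule: finite_induct)
  case (insert e Y)
  then have IH: "X \<union> Y \<in> central M" "rk M (X \<union> Y) = rk M X" by auto
  have e: "X \<union> {e} \<in> central M" "rk M (X \<union> {e}) = rk M X" using insert.prems by (auto simp: cl_def)
  show ?case
  proof (cases "e \<in> X")
    case False
    then have int: "(X \<union> {e}) \<inter> (X \<union> Y) = X" using insert.hyps by auto
    have un: "(X \<union> {e}) \<union> (X \<union> Y) = X \<union> insert e Y" by auto
    have c: "X \<union> insert e Y \<in> central M"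
      using CR1[OF e(1) IH(1)] e(2) unfolding int un by simp
    have "rk M (X \<union> insert e Y) + rk M X \<le> rk M X + rk M X"
      using R3[OF e(1) IH(1)] c e(2) IH(2) unfolding int un by simp
    moreover have "rk M X \<le> rk M (X \<union> insert e Y)" using R2[OF X c] by auto
    ultimately show ?thesis using c by simp
  qed (use IH in \<open>simp add: insert_absorb\<close>)
qed (use X in simp)

text \<open>
  Finite parts of the closure are central, so their cardinality is bounded by the dimension.
\<close>

lemma finite_cl:
  assumes X: "X \<in> central M" shows "finite (cl M X)"
proof (rule ccontr)
  assume inf: "infinite (cl M X)"
  obtain d where d: "\<And>X. X \<in> central M \<Longrightarrow> card X \<le> d" using finite_dimensional by blast
  obtain Y where Y: "Y \<subseteq> cl M X" "finite Y" "card Y = Suc d"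
    using infinite_arbitrarily_large[OF inf] by blast
  have "Y \<in> central M" using union_subset_cl[OF X Y(2,1)] central_subset by blast
  then show False using d Y(3) by fastforce
qed

lemma cl_central: "X \<in> central M \<Longrightarrow> cl M X \<in> central M"
  and rank_cl: "X \<in> central M \<Longrightarrow> rk M (cl M X) = rk M X"
  using union_subset_cl[of X "cl M X"] finite_cl subset_cl by (auto simp: Un_absorb1)

text \<open>
  The sets \<open>X \<union> {e}\<close> and \<open>Y\<close> meet in \<open>X\<close> when \<open>e\<close> is not in \<open>Y\<close>, so (CR1) and (R3) carry the
  defining property of \<open>e \<in> cl M X\<close> over to \<open>Y\<close>.
\<close>

lemma cl_mono:
  assumes X: "X \<in> central M" and Y: "Y \<in> central M" and sub: "X \<subseteq> Y"
  shows "cl M X \<subseteq> cl M Y"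
proof
  fix e assume "e \<in> cl M X"
  then have e: "e \<in> ground M" "X \<union> {e} \<in> central M" "rk M (X \<union> {e}) = rk M X" by (auto simp: cl_def)
  show "e \<in> cl M Y"
  proof (cases "e \<in> Y")
    case True
    then show ?thesis using subset_cl[OF Y] by auto
  next
    case False
    then have int: "(X \<union> {e}) \<inter> Y = X" using sub by auto
    have un: "(X \<union> {e}) \<union> Y = Y \<union> {e}" using sub by auto
    have c: "Y \<union> {e} \<in> central M" using CR1[OF e(2) Y] e(3) unfolding int un by simp
    have "rk M (Y \<union> {e}) \<le> rk M Y" using R3[OF e(2) Y] c e(3) unfolding int un by simp
    moreover have "rk M Y \<le> rk M (Y \<union> {e})" using R2[OF Y c] by auto
    ultimately show ?thesis using c e(1) by (auto simp: cl_def)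
  qed
qed

text \<open>
  Closure is idempotent, since \<open>X\<close> and \<open>cl M X\<close> have the same rank.
\<close>

lemma cl_flat:
  assumes X: "X \<in> central M" shows "cl M X \<in> flats M"
proof -
  have c: "cl M X \<in> central M" using X by (rule cl_central)
  have "cl M (cl M X) \<subseteq> cl M X"
  proof
    fix e assume "e \<in> cl M (cl M X)"
    then have e: "e \<in> ground M" "cl M X \<union> {e} \<in> central M" "rk M (cl M X \<union> {e}) = rk M X"
      by (auto simp: cl_def[of M "cl M X"] rank_cl[OF X])
    have c': "X \<union> {e} \<in> central M" using subset_cl[OF X] by (intro central_subset[OF e(2)]) auto
    have "rk M (X \<union> {e}) \<le> rk M X" using R2[OF c' e(2)] e(3) subset_cl[OF X] by auto
    moreover have "rk M X \<le> rk M (X \<union> {e})" using R2[OF X c'] by auto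
    ultimately show "e \<in> cl M X" using c' e(1) by (auto simp: cl_def)
  qed
  then show ?thesis using c subset_cl[OF c] by (auto simp: flats_def)
qed

lemma flat_central: "F \<in> flats M \<Longrightarrow> F \<in> central M"
  by (simp add: flats_def)

text \<open>
  The closure is the least flat above \<open>X\<close>. This property determines joins of flats.
\<close>

lemma cl_subset_flat_iff:
  assumes "X \<in> central M" "F \<in> flats M" shows "cl M X \<subseteq> F \<longleftrightarrow> X \<subseteq> F"
  using assms cl_mono[of X F] subset_cl[of X] by (auto simp: flats_def)

lemma flat_inter:
  assumes F: "F \<in> flats M" and G: "G \<in> flats M" shows "F \<inter> G \<in> flats M"
proof -
  have c: "F \<inter> G \<in> central M" using F central_subset by (auto simp: flats_def)
  have "cl M (F \<inter> G) \<subseteq> F \<inter> G" using cl_subset_flat_iff[OF c F] cl_subset_flat_iff[OF c G] by auto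
  then show ?thesis using cl_flat[OF c] subset_cl[OF c] by (metis subset_antisym)
qed

lemma rank_insert_flat:
  assumes F: "F \<in> flats M" and e: "e \<notin> F" "F \<union> {e} \<in> central M"
  shows "rk M (F \<union> {e}) = rk M F + 1"
proof -
  have c: "F \<in> central M" "{e} \<in> central M" using F e(2) central_subset by (auto simp: flats_def)
  have "rk M (F \<union> {e}) \<le> rk M F + rk M {e}"
    using R3[OF c e(2)] e(1) by (simp add: rank_empty)
  moreover have "rk M {e} \<le> 1" using R1[OF c(2)] by simp
  moreover have "rk M F \<le> rk M (F \<union> {e})" using R2[OF c(1) e(2)] by auto
  moreover have "rk M F \<noteq> rk M (F \<union> {e})"
    using F e c(2) central_ground[OF e(2)] by (auto simp: flats_def cl_def)
  ultimately show ?thesis by simp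
qed

lemma flat_rank_strict_mono:
  assumes F: "F \<in> flats M" and G: "G \<in> flats M" and "F \<subset> G"
  shows "rk M F < rk M G"
proof -
  obtain e where e: "e \<in> G" "e \<notin> F" using assms by auto
  have "F \<union> {e} \<in> central M" using central_subset[OF flat_central[OF G]] assms e by auto
  then show ?thesis
    using rank_insert_flat[OF F e(2)] R2[of "F \<union> {e}" G] flat_central[OF G] assms e by auto
qed

end

section \<open>The poset of flats is a geometric semilattice\<close>

text \<open>
  The bijection \<open>\<phi>\<close> labels each element of \<open>L\<close> by a flat of \<open>M\<close>, compatibly with the orders. Working in
  \<open>L\<close> through such labels, instead of in the set of flats, gives all statements at once for every poset
  isomorphic to the poset of flats, and lets two semimatroids be compared over the same \<open>L\<close>.
\<close>

locale flat_labelled_poset = partial_order L + finitary_semimatroid M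
  for L :: "('a, 'm) gorder_scheme" (structure) and M :: "'b semimatroid" +
  fixes \<phi> :: "'a \<Rightarrow> 'b set"
  assumes bij_label: "bij_betw \<phi> (carrier L) (flats M)"
    and label_subset_iff: "\<lbrakk>x \<in> carrier L; y \<in> carrier L\<rbrakk> \<Longrightarrow> \<phi> x \<subseteq> \<phi> y \<longleftrightarrow> x \<sqsubseteq> y"
begin

lemma label_flat: "x \<in> carrier L \<Longrightarrow> \<phi> x \<in> flats M"
  using bij_label by (auto simp: bij_betw_def)

lemma label_central: "x \<in> carrier L \<Longrightarrow> \<phi> x \<in> central M"
  by (intro flat_central label_flat)

lemma label_inj: "\<lbrakk>x \<in> carrier L; y \<in> carrier L; \<phi> x = \<phi> y\<rbrakk> \<Longrightarrow> x = y"
  using bij_label by (auto simp: bij_betw_def dest: inj_onD)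

lemma flat_has_label: "F \<in> flats M \<Longrightarrow> \<exists>x\<in>carrier L. \<phi> x = F"
  using bij_label by (metis bij_betw_imp_surj_on imageE)

lemma label_mono: "\<lbrakk>x \<in> carrier L; y \<in> carrier L; x \<sqsubseteq> y; e \<in> \<phi> x\<rbrakk> \<Longrightarrow> e \<in> \<phi> y"
  using label_subset_iff by blast

lemma finite_intervals:
  assumes y: "y \<in> carrier L" shows "finite \<lbrace>x..y\<rbrace>"
proof (rule finite_imageD)
  show "finite (\<phi> ` \<lbrace>x..y\<rbrace>)"
  proof (rule finite_subset)
    show "\<phi> ` \<lbrace>x..y\<rbrace> \<subseteq> Pow (\<phi> y)" using y by (intro image_subsetI PowI) (simp add: mem_interval_iff label_subset_iff)
    show "finite (Pow (\<phi> y))" using central_finite[OF label_central[OF y]] by simp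
  qed
  show "inj_on \<phi> \<lbrace>x..y\<rbrace>" by (auto intro!: inj_onI label_inj simp: mem_interval_iff)
qed

lemma rank_label_strict_mono:
  assumes "x \<in> carrier L" "y \<in> carrier L" "x \<sqsubseteq> y" "x \<noteq> y"
  shows "rk M (\<phi> x) < rk M (\<phi> y)"
  using assms label_subset_iff label_inj by (intro flat_rank_strict_mono label_flat) auto

text \<open>
  The basic way to move up in the poset of flats: any element \<open>e\<close> of \<open>\<phi> w\<close> outside \<open>\<phi> x\<close> yields a
  cover of \<open>x\<close> below \<open>w\<close>. It is a cover because adding \<open>e\<close> raises the rank by exactly one.
\<close>

lemma cover_by_element:
  assumes xw: "x \<in> carrier L" "w \<in> carrier L" "x \<sqsubseteq> w" and e: "e \<in> \<phi> w" "e \<notin> \<phi> x"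
  shows "\<exists>a. covers L a x \<and> a \<sqsubseteq> w \<and> \<phi> a = cl M (\<phi> x \<union> {e}) \<and> rk M (\<phi> a) = rk M (\<phi> x) + 1"
proof -
  have sub: "\<phi> x \<union> {e} \<subseteq> \<phi> w" using xw e label_subset_iff by auto
  have c: "\<phi> x \<union> {e} \<in> central M" using central_subset[OF label_central[OF xw(2)] sub] .
  obtain a where a: "a \<in> carrier L" "\<phi> a = cl M (\<phi> x \<union> {e})"
    using flat_has_label[OF cl_flat[OF c]] by auto
  have xa: "x \<sqsubseteq> a" "e \<in> \<phi> a"
    using subset_cl[OF c] a xw(1) by (auto simp flip: label_subset_iff)
  have aw: "a \<sqsubseteq> w"
    using a xw sub cl_subset_flat_iff[OF c label_flat[OF xw(2)]] by (simp flip: label_subset_iff)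
  have r: "rk M (\<phi> a) = rk M (\<phi> x) + 1"
    using a rank_cl[OF c] rank_insert_flat[OF label_flat[OF xw(1)] e(2) c] by simp
  have "z = x \<or> z = a" if z: "z \<in> carrier L" "x \<sqsubseteq> z" "z \<sqsubseteq> a" for z
    using rank_label_strict_mono[of x z] rank_label_strict_mono[of z a] z a(1) xw(1) r by fastforce
  then have "covers L a x" using xa e a(1) xw(1) by (auto simp: covers_iff)
  then show ?thesis using aw a r by blast
qed

text \<open>
  Every cover arises by adding an element, as \<open>cover_by_element\<close> finds a cover between
  \<open>x\<close> and \<open>y\<close>.
\<close>

lemma rank_label_covers:
  assumes "covers L y x" shows "rk M (\<phi> y) = rk M (\<phi> x) + 1"
proof -
  have xy: "x \<in> carrier L" "y \<in> carrier L" "x \<sqsubseteq> y" "x \<noteq> y" using assms by (auto simp: covers_iff)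
  then obtain e where "e \<in> \<phi> y" "e \<notin> \<phi> x" using label_subset_iff label_inj by (metis subsetI subset_antisym)
  then obtain a where a: "covers L a x" "a \<sqsubseteq> y" "rk M (\<phi> a) = rk M (\<phi> x) + 1"
    using cover_by_element xy by blast
  then have "a = y" using assms by (auto simp: covers_iff)
  then show ?thesis using a by simp
qed

lemma label_bottom:
  assumes "z \<in> carrier L" "\<phi> z = cl M {}" shows "least L z (carrier L)"
  using assms cl_subset_flat_iff[OF empty_central label_flat]
  by (auto simp: least_def simp flip: label_subset_iff)

lemma bottom_exists: "\<exists>z. least L z (carrier L) \<and> \<phi> z = cl M {}"
  using flat_has_label[OF cl_flat[OF empty_central]] label_bottom by blast

lemma least_label: "least L z (carrier L) \<Longrightarrow> \<phi> z = cl M {}"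
  using bottom_exists least_unique by blast

lemma rank_function_label: "rank_function L (\<lambda>x. rk M (\<phi> x))"
  unfolding rank_function_def
  using rank_label_covers least_label rank_cl[OF empty_central] rank_empty by auto

lemma poset_rank_label: "x \<in> carrier L \<Longrightarrow> poset_rank L x = rk M (\<phi> x)"
  using bottom_exists by (auto intro!: poset_rank_eqI[OF rank_function_label] finite_intervals)

text \<open>
  Joins are closures: \<open>s\<close> is the join of \<open>A\<close> if its label is generated by a central set \<open>X\<close> that
  has the same flats above it as the labels of \<open>A\<close>. The set \<open>X\<close> may be the union of these labels
  or a set of representatives of them.
\<close>

lemma is_lub_label:
  assumes A: "A \<subseteq> carrier L" and X: "X \<in> central M" and s: "s \<in> carrier L" "\<phi> s = cl M X"
    and gen: "\<And>F. F \<in> flats M \<Longrightarrow> X \<subseteq> F \<longleftrightarrow> (\<forall>a\<in>A. \<phi> a \<subseteq> F)"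
  shows "is_lub L s A"
proof -
  have "s \<sqsubseteq> u \<longleftrightarrow> (\<forall>a\<in>A. a \<sqsubseteq> u)" if u: "u \<in> carrier L" for u
  proof -
    have "s \<sqsubseteq> u \<longleftrightarrow> X \<subseteq> \<phi> u"
      using cl_subset_flat_iff[OF X label_flat[OF u]] s u by (simp flip: label_subset_iff)
    also have "\<dots> \<longleftrightarrow> (\<forall>a\<in>A. \<phi> a \<subseteq> \<phi> u)" by (rule gen[OF label_flat[OF u]])
    also have "\<dots> \<longleftrightarrow> (\<forall>a\<in>A. a \<sqsubseteq> u)"
      by (rule ball_cong[OF HOL.refl]) (use A u in \<open>simp add: subset_eq[of A] label_subset_iff\<close>)
    finally show ?thesis .
  qed
  then show ?thesis using A s(1) le_refl[OF s(1)] by (subst is_lub_iff) blast+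
qed

lemma join_label:
  assumes "x \<in> carrier L" "y \<in> carrier L" "\<phi> x \<union> \<phi> y \<in> central M"
  shows "\<exists>s. is_lub L s {x, y} \<and> \<phi> s = cl M (\<phi> x \<union> \<phi> y)"
proof -
  obtain s where "s \<in> carrier L" "\<phi> s = cl M (\<phi> x \<union> \<phi> y)"
    using flat_has_label[OF cl_flat[OF assms(3)]] by auto
  then show ?thesis using is_lub_label[OF _ assms(3), of "{x, y}" s] assms by auto
qed

lemma meet_label:
  assumes "x \<in> carrier L" "y \<in> carrier L"
  shows "\<exists>s. is_glb L s {x, y} \<and> \<phi> s = \<phi> x \<inter> \<phi> y"
proof -
  obtain s where "s \<in> carrier L" "\<phi> s = \<phi> x \<inter> \<phi> y"
    using flat_has_label[OF flat_inter[OF label_flat label_flat]] assms by metis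
  then show ?thesis using assms by (auto simp: is_glb_iff simp flip: label_subset_iff)
qed

text \<open>
  Joins and meets of flats between \<open>\<phi> x\<close> and \<open>\<phi> y\<close> stay in the interval, where all unions are central,
  so (R3) becomes semimodularity. The interval is atomistic because each
  element of a flat outside \<open>\<phi> x\<close> lies in one of the atoms below that flat.
\<close>

lemma geometric_interval:
  assumes xy: "x \<in> carrier L" "y \<in> carrier L" "x \<sqsubseteq> y"
  shows "geometric_lattice (interval L x y)"
proof -
  let ?I = "interval L x y"
  interpret I: partial_order ?I by (rule partial_order_interval)
  have fin: "finite \<lbrace>x..y\<rbrace>" using xy by (intro finite_intervals)
  have join: "\<exists>s. is_lub ?I s {u, v} \<and> s \<in> \<lbrace>x..y\<rbrace> \<and> \<phi> s = cl M (\<phi> u \<union> \<phi> v) \<and> \<phi> u \<union> \<phi> v \<in> central M"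
    if uv: "u \<in> \<lbrace>x..y\<rbrace>" "v \<in> \<lbrace>x..y\<rbrace>" for u v
  proof -
    have c: "\<phi> u \<union> \<phi> v \<in> central M"
      by (rule central_subset[OF label_central[OF xy(2)]])
        (use uv xy in \<open>auto simp: mem_interval_iff simp flip: label_subset_iff\<close>)
    obtain s where s: "is_lub L s {u, v}" "\<phi> s = cl M (\<phi> u \<union> \<phi> v)"
      using join_label[of u v] uv c by (auto simp: mem_interval_iff)
    have sc: "s \<in> carrier L" "u \<sqsubseteq> s" "v \<sqsubseteq> s" "\<And>w. w \<in> carrier L \<Longrightarrow> u \<sqsubseteq> w \<Longrightarrow> v \<sqsubseteq> w \<Longrightarrow> s \<sqsubseteq> w"
      using s(1) uv by (subst (asm) is_lub_iff; auto simp: mem_interval_iff)+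
    have "s \<in> \<lbrace>x..y\<rbrace>"
      using sc uv xy by (auto simp: mem_interval_iff intro: le_trans[of x u s])
    then have "is_lub ?I s {u, v}" using sc uv xy by (auto simp: is_lub_interval_iff mem_interval_iff)
    then show ?thesis using s(2) c \<open>s \<in> \<lbrace>x..y\<rbrace>\<close> by blast
  qed
  have meet: "\<exists>s. is_glb ?I s {u, v} \<and> s \<in> \<lbrace>x..y\<rbrace> \<and> \<phi> s = \<phi> u \<inter> \<phi> v"
    if uv: "u \<in> \<lbrace>x..y\<rbrace>" "v \<in> \<lbrace>x..y\<rbrace>" for u v
  proof -
    obtain s where s: "is_glb L s {u, v}" "\<phi> s = \<phi> u \<inter> \<phi> v"
      using meet_label[of u v] uv by (auto simp: mem_interval_iff)
    have sc: "s \<in> carrier L" "s \<sqsubseteq> u" "s \<sqsubseteq> v" "\<And>w. w \<in> carrier L \<Longrightarrow> w \<sqsubseteq> u \<Longrightarrow> w \<sqsubseteq> v \<Longrightarrow> w \<sqsubseteq> s"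
      using s(1) uv by (subst (asm) is_glb_iff; auto simp: mem_interval_iff)+
    have "s \<in> \<lbrace>x..y\<rbrace>"
      using sc uv xy by (auto simp: mem_interval_iff intro: le_trans[of s u y])
    then have "is_glb ?I s {u, v}" using sc uv by (subst is_glb_iff) (auto simp: mem_interval_iff)
    then show ?thesis using s(2) \<open>s \<in> \<lbrace>x..y\<rbrace>\<close> by blast
  qed
  have rank: "poset_rank ?I w = rk M (\<phi> w) - rk M (\<phi> x)" if "w \<in> \<lbrace>x..y\<rbrace>" for w
    using poset_rank_interval[OF rank_function_label xy fin that] .
  interpret I: Lattice.lattice ?I
  proof
    show "\<exists>s. is_lub ?I s {u, v}" if "u \<in> carrier ?I" "v \<in> carrier ?I" for u v
      using that join[of u v] unfolding carrier_interval by blast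
    show "\<exists>s. is_glb ?I s {u, v}" if "u \<in> carrier ?I" "v \<in> carrier ?I" for u v
      using that meet[of u v] unfolding carrier_interval by blast
  qed
  show ?thesis
  proof
    show "carrier ?I \<noteq> {}" using xy by (auto simp: at_least_at_most_def)
    show "finite (carrier ?I)" using fin by simp
    show "ranked ?I" using rank_function_interval[OF rank_function_label xy fin] by (auto simp: ranked_def)
  next
    fix w assume "w \<in> carrier ?I"
    then have w: "w \<in> carrier L" "x \<sqsubseteq> w" "w \<sqsubseteq> y" by (auto simp: mem_interval_iff)
    \<comment> \<open>All atoms of the interval below \<open>w\<close>; the set is empty for \<open>w = x\<close>, the empty join.\<close>
    let ?A = "{a. covers L a x \<and> a \<sqsubseteq> w}"
    have A: "?A \<subseteq> \<lbrace>x..y\<rbrace>" using w xy by (auto simp: mem_interval_iff covers_iff intro: le_trans[of _ w y])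
    have "w \<sqsubseteq> u" if u: "u \<in> \<lbrace>x..y\<rbrace>" and ub: "\<forall>a\<in>?A. a \<sqsubseteq> u" for u
    proof -
      have uc: "u \<in> carrier L" "x \<sqsubseteq> u" using u by (auto simp: mem_interval_iff)
      have "\<phi> w \<subseteq> \<phi> u"
      proof
        fix e assume e: "e \<in> \<phi> w"
        show "e \<in> \<phi> u"
        proof (cases "e \<in> \<phi> x")
          case True
          then show ?thesis using label_subset_iff[OF xy(1) uc(1)] uc by auto
        next
          case False
          then obtain a where a: "covers L a x" "a \<sqsubseteq> w" "\<phi> a = cl M (\<phi> x \<union> {e})"
            using cover_by_element xy(1) w e by blast
          have ac: "a \<in> carrier L" using a by (auto simp: covers_iff)
          have "\<phi> x \<union> {e} \<in> central M"
            by (rule central_subset[OF label_central[OF w(1)]])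
              (use w xy e in \<open>auto simp flip: label_subset_iff\<close>)
          then have "e \<in> \<phi> a" using a subset_cl by auto
          moreover have "a \<sqsubseteq> u" using ub a by auto
          ultimately show ?thesis using label_mono[OF ac uc(1)] by auto
        qed
      qed
      then show ?thesis using w uc by (simp add: label_subset_iff)
    qed
    then have "is_lub ?I w ?A"
      using A w xy by (subst is_lub_interval_iff) (auto simp: mem_interval_iff)
    moreover have "?A \<subseteq> atoms ?I" using xy w by (auto simp: atoms_interval covers_iff intro: le_trans[of _ w y])
    ultimately show "\<exists>A\<subseteq>atoms ?I. is_lub ?I w A" by blast
  next
    fix u v assume "u \<in> carrier ?I" "v \<in> carrier ?I"
    then have uv: "u \<in> \<lbrace>x..y\<rbrace>" "v \<in> \<lbrace>x..y\<rbrace>" by auto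
    obtain s where s: "is_lub ?I s {u, v}" "s \<in> \<lbrace>x..y\<rbrace>" "\<phi> s = cl M (\<phi> u \<union> \<phi> v)" "\<phi> u \<union> \<phi> v \<in> central M"
      using join[OF uv] by blast
    obtain m where m: "is_glb ?I m {u, v}" "m \<in> \<lbrace>x..y\<rbrace>" "\<phi> m = \<phi> u \<inter> \<phi> v"
      using meet[OF uv] by blast
    have eqs: "u \<squnion>\<^bsub>?I\<^esub> v = s" "u \<sqinter>\<^bsub>?I\<^esub> v = m"
      using I.sup_eqI[OF s(1)] I.inf_eqI[OF m(1)] by (simp_all add: join_def meet_def)
    have "rk M (\<phi> s) + rk M (\<phi> m) \<le> rk M (\<phi> u) + rk M (\<phi> v)"
      using R3[OF label_central label_central s(4)] uv s(3) m(3) rank_cl[OF s(4)] by (auto simp: mem_interval_iff)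
    moreover have "rk M (\<phi> x) \<le> rk M (\<phi> w)" if "w \<in> \<lbrace>x..y\<rbrace>" for w
      using that xy by (intro R2 label_central) (auto simp: mem_interval_iff simp flip: label_subset_iff)
    then have "rk M (\<phi> x) \<le> rk M (\<phi> w)" if "w \<in> {s, m, u, v}" for w using that m(2) s(2) uv by auto
    ultimately show "poset_rank ?I (u \<squnion>\<^bsub>?I\<^esub> v) + poset_rank ?I (u \<sqinter>\<^bsub>?I\<^esub> v) \<le> poset_rank ?I u + poset_rank ?I v"
      unfolding eqs rank[OF s(2)] rank[OF m(2)] rank[OF uv(1)] rank[OF uv(2)] by fastforce
  qed
qed

text \<open>
  Each atom of the interval is the closure of \<open>\<phi> x \<union> {e}\<close> for some \<open>e \<in> \<phi> y\<close>.
\<close>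

lemma card_interval_atoms_le:
  assumes xy: "x \<in> carrier L" "y \<in> carrier L" "x \<sqsubseteq> y"
  shows "card (atoms (interval L x y)) \<le> card (\<phi> y)"
proof (rule surj_card_le)
  let ?g = "\<lambda>e. inv_into (carrier L) \<phi> (cl M (\<phi> x \<union> {e}))"
  show "finite (\<phi> y)" using xy(2) by (intro central_finite label_central)
  show "atoms (interval L x y) \<subseteq> ?g ` \<phi> y"
  proof
    fix a assume "a \<in> atoms (interval L x y)"
    then have a: "covers L a x" "a \<sqsubseteq> y" by (auto simp: atoms_interval xy)
    then have ac: "a \<in> carrier L" "x \<sqsubseteq> a" "a \<noteq> x" by (auto simp: covers_iff)
    then obtain e where e: "e \<in> \<phi> a" "e \<notin> \<phi> x"
      using label_subset_iff label_inj xy(1) by (metis subsetI subset_antisym)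
    obtain b where b: "covers L b x" "b \<sqsubseteq> a" "\<phi> b = cl M (\<phi> x \<union> {e})"
      using cover_by_element[OF xy(1) ac(1,2) e] by blast
    then have "b = a" using a by (auto simp: covers_iff)
    then have "?g e = a"
      using inv_into_f_f[OF bij_betw_imp_inj_on[OF bij_label] ac(1)] b(3) by simp
    moreover have "e \<in> \<phi> y" using e a ac xy by (auto simp flip: label_subset_iff)
    ultimately show "a \<in> ?g ` \<phi> y" by blast
  qed
qed

text \<open>
  One element \<open>e a\<close> from each atom \<open>a\<close> suffices to generate the join, since \<open>\<phi> a = cl M {e a}\<close>.
\<close>

lemma independent_transversal:
  assumes A: "A \<subseteq> atoms L" and s: "is_lub L s A" and e: "\<And>a. a \<in> A \<Longrightarrow> \<phi> a = cl M {e a} \<and> {e a} \<in> central M"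
  shows "e ` A \<in> central M \<and> cl M (e ` A) = \<phi> s"
proof -
  have Ac: "A \<subseteq> carrier L" using A by (auto simp: atoms_def covers_iff)
  have sc: "s \<in> carrier L" "\<And>a. a \<in> A \<Longrightarrow> a \<sqsubseteq> s" using s Ac by (auto simp: is_lub_iff)
  have sub: "e ` A \<subseteq> \<phi> s"
  proof
    fix x assume "x \<in> e ` A"
    then obtain a where a: "a \<in> A" "x = e a" by auto
    have "x \<in> \<phi> a" using e[OF a(1)] a(2) subset_cl by auto
    then show "x \<in> \<phi> s" using label_mono[OF _ sc(1) sc(2)] a(1) Ac by blast
  qed
  have c: "e ` A \<in> central M" using central_subset[OF label_central[OF sc(1)] sub] .
  obtain t where t: "t \<in> carrier L" "\<phi> t = cl M (e ` A)" using flat_has_label[OF cl_flat[OF c]] by auto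
  have "is_lub L t A"
  proof (rule is_lub_label[OF Ac c t])
    show "e ` A \<subseteq> F \<longleftrightarrow> (\<forall>a\<in>A. \<phi> a \<subseteq> F)" if "F \<in> flats M" for F
      using e cl_subset_flat_iff[OF _ that] by auto
  qed
  then have "t = s" using s least_unique by blast
  then show ?thesis using c t by simp
qed

lemma atom_label:
  assumes "a \<in> atoms L" shows "\<exists>e. \<phi> a = cl M {e} \<and> {e} \<in> central M \<and> e \<in> \<phi> a"
proof -
  obtain z where z: "least L z (carrier L)" "covers L a z" using assms by (auto simp: atoms_def)
  have zl: "\<phi> z = cl M {}" using least_label z(1) .
  have ac: "a \<in> carrier L" "z \<in> carrier L" "z \<sqsubseteq> a" "a \<noteq> z" using z by (auto simp: covers_iff)
  then obtain e where e: "e \<in> \<phi> a" "e \<notin> \<phi> z" using label_subset_iff label_inj by (metis subsetI subset_antisym)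
  have c: "{e} \<in> central M" using central_subset[OF label_central[OF ac(1)]] e by auto
  obtain b where b: "b \<in> carrier L" "\<phi> b = cl M {e}" using flat_has_label[OF cl_flat[OF c]] by auto
  have "b \<sqsubseteq> a" using cl_subset_flat_iff[OF c label_flat[OF ac(1)]] b ac e by (simp flip: label_subset_iff)
  moreover have "z \<sqsubseteq> b" using z(1) b by (auto simp: least_def)
  moreover have "b \<noteq> z" using e subset_cl[OF c] b by auto
  ultimately have "b = a" using z(2) b(1) by (auto simp: covers_iff)
  then show ?thesis using b c e by blast
qed

text \<open>
  (CR2) for the flat of \<open>x\<close> and the transversal of \<open>A\<close> yields an element \<open>e a\<close> that can be added to
  \<open>\<phi> x\<close>, and the closure of \<open>\<phi> x \<union> {e a}\<close> is the join of \<open>x\<close> and \<open>a\<close>.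
\<close>

lemma independent_exchange:
  assumes ind: "independent L A" and x: "x \<in> carrier L" and lt: "poset_rank L x < poset_rank L (\<Squnion>A)"
  shows "\<exists>a\<in>A. \<not> a \<sqsubseteq> x \<and> (\<exists>z. is_lub L z {x, a})"
proof -
  have A: "A \<subseteq> atoms L" using ind by (simp add: independent_def)
  then have Ac: "A \<subseteq> carrier L" by (auto simp: atoms_def covers_iff)
  obtain s where s: "is_lub L s A" using ind by (auto simp: independent_def)
  then have sc: "s \<in> carrier L" by (rule least_closed)
  obtain e where e: "\<And>a. a \<in> A \<Longrightarrow> \<phi> a = cl M {e a} \<and> {e a} \<in> central M"
    using atom_label A by (metis subsetD)
  have Y: "e ` A \<in> central M" "cl M (e ` A) = \<phi> s" using independent_transversal[OF A s e] by auto
  have "rk M (\<phi> x) < rk M (e ` A)"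
    using lt sup_eqI[OF s] poset_rank_label sc x Y(2) rank_cl[OF Y(1)] by simp
  then obtain a where a: "a \<in> A" "e a \<notin> \<phi> x" "\<phi> x \<union> {e a} \<in> central M"
    using CR2[OF label_central[OF x] Y(1)] by auto
  have "e a \<in> \<phi> a" using e[OF a(1)] subset_cl by auto
  then have "\<not> a \<sqsubseteq> x" using label_mono[OF _ x] a Ac by blast
  moreover obtain t where t: "t \<in> carrier L" "\<phi> t = cl M (\<phi> x \<union> {e a})"
    using flat_has_label[OF cl_flat[OF a(3)]] by auto
  have "is_lub L t {x, a}"
  proof (rule is_lub_label[OF _ a(3) t])
    show "\<phi> x \<union> {e a} \<subseteq> F \<longleftrightarrow> (\<forall>b\<in>{x, a}. \<phi> b \<subseteq> F)" if "F \<in> flats M" for F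
      using e[OF a(1)] cl_subset_flat_iff[OF _ that] by auto
  qed (use a Ac x in auto)
  ultimately show ?thesis using a(1) by blast
qed

theorem is_finitary_geometric_semilattice: "finitary_geometric_semilattice L"
proof
  show "\<exists>s. is_glb L s {x, y}" if "x \<in> carrier L" "y \<in> carrier L" for x y
    using meet_label that by blast
  show "carrier L \<noteq> {}" using bottom_exists by (auto dest: least_closed)
  show "ranked L" using rank_function_label by (auto simp: ranked_def)
  show "chain_finite L" unfolding chain_finite_def
  proof (intro allI impI)
    fix K assume K: "K \<subseteq> carrier L" "\<forall>x\<in>K. \<forall>y\<in>K. x \<sqsubseteq> y \<or> y \<sqsubseteq> x"
    obtain N where N: "\<And>X. X \<in> central M \<Longrightarrow> rk M X \<le> N" using rank_bounded by blast
    show "finite K"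
    proof (rule finite_imageD)
      show "finite ((\<lambda>x. rk M (\<phi> x)) ` K)"
        by (rule finite_subset[of _ "{..N}"]) (use K N label_central in auto)
      show "inj_on (\<lambda>x. rk M (\<phi> x)) K"
        using K rank_label_strict_mono by (intro inj_onI) (metis less_irrefl subsetD)
    qed
  qed
  obtain d where d: "\<And>X. X \<in> central M \<Longrightarrow> card X \<le> d" using finite_dimensional by blast
  show "\<exists>N. \<forall>x\<in>carrier L. \<forall>y\<in>carrier L. x \<sqsubseteq> y \<longrightarrow>
      geometric_lattice (interval L x y) \<and> card (atoms (interval L x y)) \<le> N"
    using geometric_interval card_interval_atoms_le d label_central le_trans by (meson order_trans)
qed (fact independent_exchange)

end

section \<open>The semimatroid on the atoms of a geometric semilattice\<close>

definition atom_semimatroid :: "('a, 'm) gorder_scheme \<Rightarrow> 'a semimatroid" where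
  "atom_semimatroid L = \<lparr>ground = atoms L,
     central = {X. X \<subseteq> atoms L \<and> (\<exists>u\<in>carrier L. \<forall>a\<in>X. a \<sqsubseteq>\<^bsub>L\<^esub> u)},
     rk = (\<lambda>X. poset_rank L (\<Squnion>\<^bsub>L\<^esub>X))\<rparr>"

lemma atom_semimatroid_simps [simp]:
  "ground (atom_semimatroid L) = atoms L"
  "rk (atom_semimatroid L) X = poset_rank L (\<Squnion>\<^bsub>L\<^esub>X)"
  by (simp_all add: atom_semimatroid_def)

lemma central_atom_semimatroid_iff:
  "X \<in> central (atom_semimatroid L) \<longleftrightarrow> X \<subseteq> atoms L \<and> (\<exists>u\<in>carrier L. \<forall>a\<in>X. a \<sqsubseteq>\<^bsub>L\<^esub> u)"
  by (simp add: atom_semimatroid_def)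

lemma central_atom_semimatroidI:
  fixes L (structure)
  assumes "X \<subseteq> atoms L" "u \<in> carrier L" "\<And>a. a \<in> X \<Longrightarrow> a \<sqsubseteq> u"
  shows "X \<in> central (atom_semimatroid L)"
  using assms unfolding central_atom_semimatroid_iff by blast

lemma central_atoms: "X \<in> central (atom_semimatroid L) \<Longrightarrow> X \<subseteq> atoms L"
  by (simp add: central_atom_semimatroid_iff)

lemma (in partial_order) is_lub_union:
  assumes "X \<subseteq> carrier L" "Y \<subseteq> carrier L" and s: "is_lub L s X" and t: "is_lub L t Y"
    and j: "is_lub L j {s, t}"
  shows "is_lub L j (X \<union> Y)"
proof -
  have c: "s \<in> carrier L" "t \<in> carrier L" "j \<in> carrier L" using s t j by auto
  have st: "s \<sqsubseteq> j" "t \<sqsubseteq> j" "\<And>u. \<lbrakk>u \<in> carrier L; s \<sqsubseteq> u; t \<sqsubseteq> u\<rbrakk> \<Longrightarrow> j \<sqsubseteq> u"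
    using j c by (auto simp: is_lub_iff)
  have X: "\<And>a. a \<in> X \<Longrightarrow> a \<sqsubseteq> s" "\<And>u. \<lbrakk>u \<in> carrier L; \<forall>a\<in>X. a \<sqsubseteq> u\<rbrakk> \<Longrightarrow> s \<sqsubseteq> u"
    using s assms(1) by (auto simp: is_lub_iff)
  have Y: "\<And>a. a \<in> Y \<Longrightarrow> a \<sqsubseteq> t" "\<And>u. \<lbrakk>u \<in> carrier L; \<forall>a\<in>Y. a \<sqsubseteq> u\<rbrakk> \<Longrightarrow> t \<sqsubseteq> u"
    using t assms(2) by (auto simp: is_lub_iff)
  have "a \<sqsubseteq> j" if "a \<in> X \<union> Y" for a
    using that X(1) Y(1) le_trans[of a s j] le_trans[of a t j] st c assms(1,2) by blast
  then show ?thesis using c st X(2) Y(2) assms(1,2) by (subst is_lub_iff) auto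
qed

lemma (in partial_order) is_lub_singleton: "a \<in> carrier L \<Longrightarrow> is_lub L a {a}"
  by (simp add: is_lub_iff)

context finitary_geometric_semilattice
begin

lemma rank_function_poset_rank: "rank_function L (poset_rank L)"
  using ranked unfolding ranked_def poset_rank_def by (rule someI_ex)

lemma finite_interval:
  assumes "x \<in> carrier L" "y \<in> carrier L" "x \<sqsubseteq> y" shows "finite \<lbrace>x..y\<rbrace>"
proof -
  have "geometric_lattice (interval L x y)" using G3 assms by blast
  then show ?thesis using geometric_lattice.finite_carrier by fastforce
qed

lemma poset_rank_mono:
  "\<lbrakk>x \<in> carrier L; y \<in> carrier L; x \<sqsubseteq> y\<rbrakk> \<Longrightarrow> poset_rank L x \<le> poset_rank L y"
  by (rule rank_function_mono[OF rank_function_poset_rank]) (auto intro: finite_interval)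

lemma eq_if_rank_le:
  "\<lbrakk>x \<in> carrier L; y \<in> carrier L; x \<sqsubseteq> y; poset_rank L y \<le> poset_rank L x\<rbrakk> \<Longrightarrow> x = y"
  using rank_function_strict_mono[OF rank_function_poset_rank, of x y] finite_interval[of x y] by fastforce

text \<open>
  An element \<open>z\<close> of least rank is the minimum: its meet with any \<open>y\<close> lies below \<open>z\<close> and cannot have
  smaller rank, so it is \<open>z\<close>.
\<close>

lemma least_exists: "\<exists>z. least L z (carrier L)"
proof -
  obtain z where z: "z \<in> carrier L" "\<And>y. y \<in> carrier L \<Longrightarrow> poset_rank L z \<le> poset_rank L y"
    using ex_has_least_nat[of "\<lambda>x. x \<in> carrier L"] nonempty by blast
  have "z \<sqsubseteq> y" if y: "y \<in> carrier L" for y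
  proof -
    have "z \<sqinter> y = z" using z y by (intro eq_if_rank_le) (auto intro: meet_left)
    then show ?thesis using meet_right[OF z(1) y] by simp
  qed
  then show ?thesis using z by (auto simp: least_def)
qed

end

sublocale finitary_geometric_semilattice \<subseteq> weak_partial_order_bottom L
  by unfold_locales (rule least_exists)

context finitary_geometric_semilattice
begin

lemma atoms_iff: "a \<in> atoms L \<longleftrightarrow> covers L a \<bottom>"
proof -
  have "least L z (carrier L) \<longleftrightarrow> z = \<bottom>" for z
    by (rule iffI, rule least_unique, assumption, rule bottom_least, simp add: bottom_least)
  then show ?thesis by (simp add: atoms_def)
qed

lemma atom_closed: "a \<in> atoms L \<Longrightarrow> a \<in> carrier L"
  by (simp add: atoms_iff covers_iff)

lemma poset_rank_bottom: "poset_rank L \<bottom> = 0"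
  using rank_function_poset_rank bottom_least by (simp add: rank_function_def)

lemma poset_rank_atom: "a \<in> atoms L \<Longrightarrow> poset_rank L a = 1"
  using rank_function_poset_rank poset_rank_bottom atom_closed[of a] bottom_closed
  unfolding rank_function_def atoms_iff by (metis add_0)

lemma is_lub_bottom: "is_lub L \<bottom> {}"
  using bottom_least by simp

lemma poset_rank_lower_interval:
  "\<lbrakk>u \<in> carrier L; x \<in> \<lbrace>\<bottom>..u\<rbrace>\<rbrakk> \<Longrightarrow> poset_rank (interval L \<bottom> u) x = poset_rank L x"
  using poset_rank_interval[OF rank_function_poset_rank, of \<bottom> u x] finite_interval[of \<bottom> u]
  by (simp add: poset_rank_bottom)

lemma geometric_lower_interval: "u \<in> carrier L \<Longrightarrow> geometric_lattice (interval L \<bottom> u)"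
  using G3 bottom_lower[of u] bottom_closed by metis

text \<open>
  The join in the lattice \<open>\<lbrace>\<bottom>..u\<rbrace>\<close> is also the join in \<open>L\<close>, because any upper bound \<open>w\<close> in \<open>L\<close> may be
  replaced by \<open>w \<sqinter> u\<close>. The rank inequality is semimodularity of that lattice.
\<close>

lemma bounded_join:
  assumes x: "x \<in> carrier L" "x \<sqsubseteq> u" and y: "y \<in> carrier L" "y \<sqsubseteq> u" and u: "u \<in> carrier L"
  shows "\<exists>s. is_lub L s {x, y} \<and> poset_rank L s + poset_rank L (x \<sqinter> y) \<le> poset_rank L x + poset_rank L y"
proof -
  let ?I = "interval L \<bottom> u"
  interpret G: geometric_lattice ?I using u by (rule geometric_lower_interval)
  have xy: "x \<in> \<lbrace>\<bottom>..u\<rbrace>" "y \<in> \<lbrace>\<bottom>..u\<rbrace>" using x y by (auto simp: mem_interval_iff)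
  obtain s where s: "is_lub ?I s {x, y}" using G.sup_of_two_exists xy by auto
  have su: "s \<in> \<lbrace>\<bottom>..u\<rbrace>" "x \<sqsubseteq> s" "y \<sqsubseteq> s"
    and least: "\<And>w. \<lbrakk>w \<in> \<lbrace>\<bottom>..u\<rbrace>; x \<sqsubseteq> w; y \<sqsubseteq> w\<rbrakk> \<Longrightarrow> s \<sqsubseteq> w"
    using s xy u by (subst (asm) is_lub_interval_iff; auto)+
  have sc: "s \<in> carrier L" using su by (simp add: mem_interval_iff)
  have "s \<sqsubseteq> w" if w: "w \<in> carrier L" "x \<sqsubseteq> w" "y \<sqsubseteq> w" for w
  proof -
    \<comment> \<open>\<open>s\<close> is least only among the upper bounds in \<open>\<lbrace>\<bottom>..u\<rbrace>\<close>, so \<open>w\<close> is first moved there.\<close>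
    have "s \<sqsubseteq> w \<sqinter> u"
      using w x y u by (intro least) (auto simp: mem_interval_iff intro: meet_le meet_right)
    then show ?thesis using meet_left[OF w(1) u] sc w u by (meson le_trans meet_closed)
  qed
  then have lub: "is_lub L s {x, y}" using sc su x y by (auto simp: is_lub_iff)
  have m: "x \<sqinter> y \<in> \<lbrace>\<bottom>..u\<rbrace>"
    using x y u meet_left[OF x(1) y(1)] by (auto simp: mem_interval_iff intro: le_trans[of "x \<sqinter> y" x u])
  have "is_glb ?I (x \<sqinter> y) {x, y}"
    using m xy by (subst is_glb_iff) (auto simp: mem_interval_iff intro: meet_left meet_right meet_le)
  then have "x \<sqinter>\<^bsub>?I\<^esub> y = x \<sqinter> y" "x \<squnion>\<^bsub>?I\<^esub> y = s"
    using G.inf_eqI G.sup_eqI[OF s] by (auto simp: meet_def join_def)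
  then show ?thesis
    using G.semimodular[of x y] lub xy m su(1) u by (auto simp: poset_rank_lower_interval)
qed

text \<open>
  In the atomistic lattice \<open>\<lbrace>\<bottom>..x\<rbrace>\<close>, the element \<open>x\<close> is a join of atoms, and \<open>x \<sqinter> y\<close> is an upper bound
  of these atoms.
\<close>

lemma le_if_atoms_le:
  assumes x: "x \<in> carrier L" and y: "y \<in> carrier L"
    and le: "\<And>a. \<lbrakk>a \<in> atoms L; a \<sqsubseteq> x\<rbrakk> \<Longrightarrow> a \<sqsubseteq> y"
  shows "x \<sqsubseteq> y"
proof -
  let ?I = "interval L \<bottom> x"
  interpret G: geometric_lattice ?I using x by (rule geometric_lower_interval)
  have x': "x \<in> \<lbrace>\<bottom>..x\<rbrace>" using x by (simp add: mem_interval_iff)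
  obtain A where A: "A \<subseteq> atoms ?I" "is_lub ?I x A" using G.atomistic[of x] x' by auto
  have A': "A \<subseteq> {a \<in> atoms L. a \<sqsubseteq> x}"
    using A(1) x by (auto simp: atoms_interval atoms_iff)
  then have sub: "A \<subseteq> \<lbrace>\<bottom>..x\<rbrace>" using atom_closed by (auto simp: mem_interval_iff)
  have "x \<sqsubseteq> x \<sqinter> y"
  proof -
    have "x \<sqinter> y \<in> \<lbrace>\<bottom>..x\<rbrace>" using x y by (auto simp: mem_interval_iff intro: meet_left)
    moreover have "a \<sqsubseteq> x \<sqinter> y" if "a \<in> A" for a
    proof -
      have "a \<in> atoms L" "a \<sqsubseteq> x" using A' that by auto
      then show ?thesis using x y le atom_closed by (intro meet_le) auto
    qed
    ultimately show ?thesis using A(2) sub x by (subst (asm) is_lub_interval_iff) auto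
  qed
  then show ?thesis using meet_right[OF x y] x y by (meson le_trans meet_closed)
qed

lemma finite_atoms_below: "u \<in> carrier L \<Longrightarrow> finite {a \<in> atoms L. a \<sqsubseteq> u}"
  by (rule finite_subset[OF _ finite_interval[of \<bottom> u]]) (auto simp: mem_interval_iff atom_closed)

text \<open>
  A bounded set of atoms has a join and contains an independent set with the same join. The atoms are
  added one by one; a new atom either lies below the join reached so far and is dropped, or it
  raises the rank by exactly one, by semimodularity.
\<close>

lemma bounded_atoms_basis:
  assumes X: "X \<subseteq> atoms L" and u: "u \<in> carrier L" "\<And>a. a \<in> X \<Longrightarrow> a \<sqsubseteq> u"
  shows "\<exists>s A. is_lub L s X \<and> A \<subseteq> X \<and> independent L A \<and> is_lub L s A"
proof -
  have "finite X" by (rule finite_subset[OF _ finite_atoms_below[OF u(1)]]) (use X u in auto)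
  then show ?thesis using X u(2)
  proof (induction rule: finite_induct)
    case empty
    have "independent L {}"
      using is_lub_bottom sup_eqI[OF is_lub_bottom] poset_rank_bottom by (auto simp: independent_def)
    then show ?case using is_lub_bottom by blast
  next
    case (insert a X)
    then obtain t A where t: "is_lub L t X" "A \<subseteq> X" "independent L A" "is_lub L t A" by auto
    have Xc: "X \<subseteq> carrier L" "A \<subseteq> carrier L" and a: "a \<in> carrier L" "a \<in> atoms L"
      using insert.prems t(2) atom_closed by auto
    have tc: "t \<in> carrier L" "t \<sqsubseteq> u" "\<And>b. b \<in> A \<Longrightarrow> b \<sqsubseteq> t"
      using t(1,4) Xc u insert.prems by (auto simp: is_lub_iff)
    obtain j where j: "is_lub L j {t, a}"
      and rj: "poset_rank L j + poset_rank L (t \<sqinter> a) \<le> poset_rank L t + poset_rank L a"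
      using bounded_join[OF tc(1,2) a(1) _ u(1)] insert.prems by auto
    have jX: "is_lub L j (insert a X)" "is_lub L j (insert a A)"
      using is_lub_union[OF _ _ _ is_lub_singleton[OF a(1)] j] t(1,4) Xc a(1) by auto
    show ?case
    proof (cases "a \<sqsubseteq> t")
      case True
      then have "is_lub L t {t, a}" using tc a by (auto simp: is_lub_iff)
      then have "j = t" using j least_unique by blast
      then show ?thesis using jX(1) t by blast
    next
      case False
      then have "a \<notin> A" using tc by auto
      have jc: "j \<in> carrier L" "t \<sqsubseteq> j" "a \<sqsubseteq> j" using j tc a by (auto simp: is_lub_iff)
      \<comment> \<open>The rank increases strictly, and by at most \<open>poset_rank L a = 1\<close>.\<close>
      have "poset_rank L t < poset_rank L j"
        using eq_if_rank_le[OF tc(1) jc(1,2)] jc(3) False by fastforce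
      then have "poset_rank L j = Suc (poset_rank L t)" using rj poset_rank_atom[OF a(2)] by simp
      then have "independent L (insert a A)"
        using t(3) a(2) jX(2) sup_eqI[OF jX(2)] sup_eqI[OF t(4)] \<open>a \<notin> A\<close> by (auto simp: independent_def)
      then show ?thesis using jX t(2) by blast
    qed
  qed
qed

lemma central_sup_basis:
  assumes X: "X \<in> central (atom_semimatroid L)"
  shows is_lub_sup: "is_lub L (\<Squnion>X) X"
    and central_basis: "\<exists>A\<subseteq>X. independent L A \<and> \<Squnion>A = \<Squnion>X"
proof -
  obtain u where u: "X \<subseteq> atoms L" "u \<in> carrier L" "\<forall>a\<in>X. a \<sqsubseteq> u"
    using X unfolding central_atom_semimatroid_iff by blast
  obtain s A where "is_lub L s X" "A \<subseteq> X" "independent L A" "is_lub L s A"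
    using bounded_atoms_basis[OF u(1,2)] u(3) by blast
  then show "is_lub L (\<Squnion>X) X" "\<exists>A\<subseteq>X. independent L A \<and> \<Squnion>A = \<Squnion>X"
    using sup_eqI[of s X] sup_eqI[of s A] by auto
qed

lemma sup_central:
  assumes X: "X \<in> central (atom_semimatroid L)"
  shows sup_closed: "\<Squnion>X \<in> carrier L"
    and le_sup: "\<And>a. a \<in> X \<Longrightarrow> a \<sqsubseteq> \<Squnion>X"
    and sup_le: "\<And>u. \<lbrakk>u \<in> carrier L; \<And>a. a \<in> X \<Longrightarrow> a \<sqsubseteq> u\<rbrakk> \<Longrightarrow> \<Squnion>X \<sqsubseteq> u"
proof -
  have "X \<subseteq> carrier L" using central_atoms[OF X] atom_closed by auto
  then show "\<Squnion>X \<in> carrier L" "\<And>a. a \<in> X \<Longrightarrow> a \<sqsubseteq> \<Squnion>X"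
    "\<And>u. \<lbrakk>u \<in> carrier L; \<And>a. a \<in> X \<Longrightarrow> a \<sqsubseteq> u\<rbrakk> \<Longrightarrow> \<Squnion>X \<sqsubseteq> u"
    using is_lub_sup[OF X] by (auto simp: is_lub_iff)
qed

lemma sup_mono:
  assumes "X \<in> central (atom_semimatroid L)" "Y \<in> central (atom_semimatroid L)" "X \<subseteq> Y"
  shows "\<Squnion>X \<sqsubseteq> \<Squnion>Y"
  using assms by (intro sup_le[OF assms(1)] sup_closed le_sup[OF assms(2)]) auto

text \<open>
  For (R1) the rank of \<open>X\<close> is the size of an independent subset. (CR1) holds since \<open>\<Squnion>X\<close> and
  \<open>\<Squnion>(X \<inter> Y)\<close> coincide when they have equal rank, so \<open>\<Squnion>Y\<close> bounds \<open>X \<union> Y\<close>. The upper bound \<open>N\<close> for the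
  number of atoms in an interval bounds the size of central sets.
\<close>

theorem simple_atom_semimatroid: "simple_finitary_semimatroid (atom_semimatroid L)"
proof -
  let ?M = "atom_semimatroid L"
  have sub: "Y \<in> central ?M" if "X \<in> central ?M" "Y \<subseteq> X" for X Y using that unfolding central_atom_semimatroid_iff by blast
  have fin: "finite X" if X: "X \<in> central ?M" for X
    by (rule finite_subset[OF _ finite_atoms_below[OF sup_closed[OF X]]]) (use central_atoms[OF X] le_sup[OF X] in auto)
  have sing: "{x} \<in> central ?M" if "x \<in> atoms L" for x
    using that atom_closed by (intro central_atom_semimatroidI[where u = x]) auto
  have R1: "poset_rank L (\<Squnion>X) \<le> card X" if X: "X \<in> central ?M" for X
  proof -
    obtain A where A: "A \<subseteq> X" "independent L A" "\<Squnion>A = \<Squnion>X" using central_basis[OF X] by blast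
    then show ?thesis using card_mono[OF fin[OF X] A(1)] by (simp add: independent_def)
  qed
  obtain N where N: "\<And>x y. \<lbrakk>x \<in> carrier L; y \<in> carrier L; x \<sqsubseteq> y\<rbrakk> \<Longrightarrow> card (atoms (interval L x y)) \<le> N"
    using G3 by blast
  have dim: "card X \<le> N" if X: "X \<in> central ?M" for X
  proof -
    have u: "\<Squnion>X \<in> carrier L" by (rule sup_closed[OF X])
    have "card X \<le> card {a \<in> atoms L. a \<sqsubseteq> \<Squnion>X}"
      by (rule card_mono[OF finite_atoms_below[OF u]]) (use central_atoms[OF X] le_sup[OF X] in auto)
    also have "{a \<in> atoms L. a \<sqsubseteq> \<Squnion>X} = atoms (interval L \<bottom> (\<Squnion>X))"
      using u by (auto simp: atoms_interval atoms_iff)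
    also have "card \<dots> \<le> N" using N u by simp
    finally show ?thesis .
  qed
  show ?thesis
  proof
    show "central ?M \<noteq> {}" using central_atom_semimatroidI[of "{}" L \<bottom>] bottom_closed by blast
    show "X \<subseteq> ground ?M" if "X \<in> central ?M" for X using central_atoms[OF that] by simp
    show "finite X" if "X \<in> central ?M" for X using that by (rule fin)
    show "Y \<in> central ?M" if "X \<in> central ?M" "Y \<subseteq> X" for X Y using that by (rule sub)
    show "{x} \<in> central ?M" if "x \<in> ground ?M" for x using that sing by simp
    show "\<exists>d. \<forall>X\<in>central ?M. card X \<le> d" using dim by blast
    show "\<exists>N. \<forall>X\<in>central ?M. rk ?M X \<le> N"
      unfolding atom_semimatroid_simps using dim R1 by (meson order_trans)
    show "rk ?M X \<le> card X" if "X \<in> central ?M" for X using R1[OF that] by simp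
    show "rk ?M X \<le> rk ?M Y" if "X \<in> central ?M" "Y \<in> central ?M" "X \<subseteq> Y" for X Y
      using poset_rank_mono[OF sup_closed sup_closed sup_mono] that by simp
  next
    fix X Y assume c: "X \<in> central ?M" "Y \<in> central ?M" "X \<union> Y \<in> central ?M"
    have i: "X \<inter> Y \<in> central ?M" by (rule sub[OF c(1) Int_lower1])
    have Xc: "X \<subseteq> carrier L" "Y \<subseteq> carrier L"
      using central_atoms[OF c(1)] central_atoms[OF c(2)] atom_closed by auto
    have le: "\<Squnion>X \<sqsubseteq> \<Squnion>(X \<union> Y)" "\<Squnion>Y \<sqsubseteq> \<Squnion>(X \<union> Y)" using sup_mono[OF c(1,3)] sup_mono[OF c(2,3)] by simp_all
    obtain s where s: "is_lub L s {\<Squnion>X, \<Squnion>Y}"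
      and r: "poset_rank L s + poset_rank L (\<Squnion>X \<sqinter> \<Squnion>Y) \<le> poset_rank L (\<Squnion>X) + poset_rank L (\<Squnion>Y)"
      using bounded_join[OF sup_closed[OF c(1)] le(1) sup_closed[OF c(2)] le(2) sup_closed[OF c(3)]] by blast
    have "\<Squnion>(X \<union> Y) = s"
      using is_lub_union[OF Xc is_lub_sup[OF c(1)] is_lub_sup[OF c(2)] s] by (rule sup_eqI)
    moreover have "\<Squnion>(X \<inter> Y) \<sqsubseteq> \<Squnion>X \<sqinter> \<Squnion>Y"
      using sup_mono[OF i c(1)] sup_mono[OF i c(2)]
      by (intro meet_le sup_closed[OF c(1)] sup_closed[OF c(2)] sup_closed[OF i]) simp_all
    then have "poset_rank L (\<Squnion>(X \<inter> Y)) \<le> poset_rank L (\<Squnion>X \<sqinter> \<Squnion>Y)"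
      by (intro poset_rank_mono sup_closed[OF i] meet_closed sup_closed[OF c(1)] sup_closed[OF c(2)])
    ultimately show "rk ?M (X \<union> Y) + rk ?M (X \<inter> Y) \<le> rk ?M X + rk ?M Y" using r by simp
  next
    fix X Y assume c: "X \<in> central ?M" "Y \<in> central ?M" and r: "rk ?M X = rk ?M (X \<inter> Y)"
    have i: "X \<inter> Y \<in> central ?M" by (rule sub[OF c(1) Int_lower1])
    have "\<Squnion>(X \<inter> Y) = \<Squnion>X"
      using eq_if_rank_le[OF sup_closed[OF i] sup_closed[OF c(1)] sup_mono[OF i c(1)]] r by simp
    then have "\<Squnion>X \<sqsubseteq> \<Squnion>Y" using sup_mono[OF i c(2)] by simp
    then have "a \<sqsubseteq> \<Squnion>Y" if "a \<in> X \<union> Y" for a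
      using that le_sup[OF c(1)] le_sup[OF c(2)] le_trans[of a "\<Squnion>X" "\<Squnion>Y"]
        sup_closed[OF c(1)] sup_closed[OF c(2)] central_atoms[OF c(1)] atom_closed by blast
    then show "X \<union> Y \<in> central ?M"
      using central_atoms[OF c(1)] central_atoms[OF c(2)] sup_closed[OF c(2)]
      by (intro central_atom_semimatroidI[where u = "\<Squnion>Y"]) auto
  next
    fix X Y assume c: "X \<in> central ?M" "Y \<in> central ?M" and r: "rk ?M X < rk ?M Y"
    obtain A where A: "A \<subseteq> Y" "independent L A" "\<Squnion>A = \<Squnion>Y" using central_basis[OF c(2)] by blast
    obtain a z where a: "a \<in> A" "\<not> a \<sqsubseteq> \<Squnion>X" "is_lub L z {\<Squnion>X, a}"
      using G4[OF A(2) sup_closed[OF c(1)]] r A(3) by auto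
    have aa: "a \<in> atoms L" using a(1) A(1) central_atoms[OF c(2)] by auto
    have z: "z \<in> carrier L" "\<Squnion>X \<sqsubseteq> z" "a \<sqsubseteq> z"
      using a(3) sup_closed[OF c(1)] atom_closed[OF aa] by (auto simp: is_lub_iff)
    have "b \<sqsubseteq> z" if "b \<in> X \<union> {a}" for b
      using that z le_sup[OF c(1)] le_trans[of b "\<Squnion>X" z] sup_closed[OF c(1)]
        central_atoms[OF c(1)] atom_closed by blast
    then have "X \<union> {a} \<in> central ?M"
      using central_atoms[OF c(1)] aa z(1) by (intro central_atom_semimatroidI[where u = z]) auto
    moreover have "a \<in> Y - X" using a A le_sup[OF c(1)] by auto
    ultimately show "\<exists>y\<in>Y - X. X \<union> {y} \<in> central ?M" by blast
  next
    fix x assume "x \<in> ground ?M"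
    then show "rk ?M {x} = 1"
      using sup_eqI[OF is_lub_singleton[OF atom_closed]] poset_rank_atom by simp
  next
    fix x y assume c: "{x, y} \<in> central ?M" and ne: "x \<noteq> y"
    have at: "x \<in> atoms L" "y \<in> atoms L" using central_atoms[OF c] by auto
    have xs: "x \<sqsubseteq> \<Squnion>{x, y}" "y \<sqsubseteq> \<Squnion>{x, y}" using le_sup[OF c] by auto
    have "\<not> poset_rank L (\<Squnion>{x, y}) \<le> 1"
    proof
      assume "poset_rank L (\<Squnion>{x, y}) \<le> 1"
      then have "x = \<Squnion>{x, y}" "y = \<Squnion>{x, y}"
        using eq_if_rank_le[OF atom_closed sup_closed[OF c]] at xs poset_rank_atom by auto
      then show False using ne by simp
    qed
    moreover have "poset_rank L (\<Squnion>{x, y}) \<le> 2" using R1[OF c] ne by simp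
    ultimately show "rk ?M {x, y} = 2" by simp
  qed
qed

lemma cl_atom_semimatroid:
  assumes X: "X \<in> central (atom_semimatroid L)"
  shows "cl (atom_semimatroid L) X = {a \<in> atoms L. a \<sqsubseteq> \<Squnion>X}"
proof -
  have "X \<union> {a} \<in> central (atom_semimatroid L) \<and> poset_rank L (\<Squnion>(X \<union> {a})) = poset_rank L (\<Squnion>X)
    \<longleftrightarrow> a \<sqsubseteq> \<Squnion>X" if a: "a \<in> atoms L" for a
  proof
    assume h: "X \<union> {a} \<in> central (atom_semimatroid L) \<and> poset_rank L (\<Squnion>(X \<union> {a})) = poset_rank L (\<Squnion>X)"
    then have c: "X \<union> {a} \<in> central (atom_semimatroid L)" by blast
    have "\<Squnion>X = \<Squnion>(X \<union> {a})"
      using h by (intro eq_if_rank_le sup_closed[OF X] sup_closed[OF c] sup_mono[OF X c]) auto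
    then show "a \<sqsubseteq> \<Squnion>X" using le_sup[OF c, of a] by simp
  next
    assume le: "a \<sqsubseteq> \<Squnion>X"
    then have c: "X \<union> {a} \<in> central (atom_semimatroid L)"
      using central_atoms[OF X] a sup_closed[OF X] le_sup[OF X]
      by (intro central_atom_semimatroidI[where u = "\<Squnion>X"]) auto
    have "\<Squnion>(X \<union> {a}) \<sqsubseteq> \<Squnion>X" using le le_sup[OF X] sup_closed[OF X] by (intro sup_le[OF c]) auto
    then have "\<Squnion>(X \<union> {a}) = \<Squnion>X"
      using sup_mono[OF X c Un_upper1] sup_closed[OF X] sup_closed[OF c] by (intro le_antisym)
    then show "X \<union> {a} \<in> central (atom_semimatroid L) \<and> poset_rank L (\<Squnion>(X \<union> {a})) = poset_rank L (\<Squnion>X)"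
      using c by simp
  qed
  then show ?thesis unfolding cl_def by auto
qed

text \<open>
  The flats are the sets of all atoms below some element, by \<open>cl_atom_semimatroid\<close>, and that element is
  the join of the set since lower intervals are atomistic.
\<close>

theorem atom_labelling:
  "flat_labelled_poset L (atom_semimatroid L) (\<lambda>x. {a \<in> atoms L. a \<sqsubseteq> x})"
proof -
  let ?M = "atom_semimatroid L" and ?\<phi> = "\<lambda>x. {a \<in> atoms L. a \<sqsubseteq> x}"
  interpret M: simple_finitary_semimatroid ?M by (rule simple_atom_semimatroid)
  have le_iff: "?\<phi> x \<subseteq> ?\<phi> y \<longleftrightarrow> x \<sqsubseteq> y" if xy: "x \<in> carrier L" "y \<in> carrier L" for x y
  proof
    assume "?\<phi> x \<subseteq> ?\<phi> y" then show "x \<sqsubseteq> y" by (intro le_if_atoms_le[OF xy]) blast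
  next
    assume le: "x \<sqsubseteq> y"
    have "a \<sqsubseteq> y" if "a \<in> atoms L" "a \<sqsubseteq> x" for a
      by (rule le_trans[OF that(2) le atom_closed[OF that(1)] xy])
    then show "?\<phi> x \<subseteq> ?\<phi> y" by blast
  qed
  have flat: "?\<phi> x \<in> flats ?M" if x: "x \<in> carrier L" for x
  proof -
    have c: "?\<phi> x \<in> central ?M" using x by (intro central_atom_semimatroidI[where u = x]) auto
    have "\<Squnion>(?\<phi> x) = x"
    proof (rule sup_eqI, subst is_lub_iff)
      show "?\<phi> x \<subseteq> carrier L" using atom_closed by blast
      show "x \<in> carrier L \<and> (\<forall>a\<in>?\<phi> x. a \<sqsubseteq> x) \<and> (\<forall>u\<in>carrier L. (\<forall>a\<in>?\<phi> x. a \<sqsubseteq> u) \<longrightarrow> x \<sqsubseteq> u)"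
        using x le_if_atoms_le[OF x] by blast
    qed
    then show ?thesis using c cl_atom_semimatroid[OF c] by (simp add: flats_def)
  qed
  show ?thesis
  proof (intro flat_labelled_poset.intro flat_labelled_poset_axioms.intro)
    show "bij_betw ?\<phi> (carrier L) (flats ?M)"
    proof (rule bij_betw_imageI)
      show "inj_on ?\<phi> (carrier L)"
      proof (rule inj_onI)
        fix x y assume xy: "x \<in> carrier L" "y \<in> carrier L" "?\<phi> x = ?\<phi> y"
        then show "x = y" using le_iff[of x y] le_iff[of y x] by (intro le_antisym) simp_all
      qed
      show "?\<phi> ` carrier L = flats ?M"
      proof
        show "?\<phi> ` carrier L \<subseteq> flats ?M" using flat by blast
        show "flats ?M \<subseteq> ?\<phi> ` carrier L"
        proof
          fix F assume F: "F \<in> flats ?M"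
          then have c: "F \<in> central ?M" by (rule M.flat_central)
          have "F = ?\<phi> (\<Squnion>F)" using F cl_atom_semimatroid[OF c] by (simp add: flats_def)
          then show "F \<in> ?\<phi> ` carrier L" using sup_closed[OF c] by blast
        qed
      qed
    qed
  qed (use le_iff in \<open>unfold_locales; blast\<close>)+
qed

end

section \<open>Uniqueness of the simple semimatroid\<close>

lemma weak_partial_order_flats: "weak_partial_order (poset_of_flats M)"
  by unfold_locales (auto simp: poset_of_flats_def)

lemma poset_isomorphic_flats_iff:
  assumes "partial_order L" "finitary_semimatroid M"
  shows "poset_isomorphic L (poset_of_flats M) \<longleftrightarrow> (\<exists>\<phi>. flat_labelled_poset L M \<phi>)"
proof -
  interpret partial_order L by fact
  have "bij_betw \<phi> (carrier L) (carrier (poset_of_flats M)) \<and> order_emb L (poset_of_flats M) \<phi>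
    \<longleftrightarrow> flat_labelled_poset L M \<phi>" for \<phi>
    using assms weak_partial_order_axioms weak_partial_order_flats[of M]
    by (auto simp: flat_labelled_poset_def flat_labelled_poset_axioms_def order_emb_def poset_of_flats_def)
  then show ?thesis by (simp add: poset_isomorphic_def)
qed

text \<open>
  In a simple semimatroid singletons are flats, and they are the atoms of the poset of flats; \<open>\<eta> e\<close>
  is the atom of \<open>L\<close> that corresponds to \<open>{e}\<close>. A set \<open>X\<close> is central iff it is contained in a flat
  \<open>\<phi> u\<close>, that is, iff \<open>u\<close> is an upper bound of \<open>\<eta> ` X\<close>. Its rank is the rank of its closure, the
  label of the join of \<open>\<eta> ` X\<close>.
\<close>

lemma simple_isomorphic_atom_semimatroid:
  assumes "partial_order L" "simple_finitary_semimatroid M" "poset_isomorphic L (poset_of_flats M)"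
  shows "semimatroid_isomorphic M (atom_semimatroid L)"
proof -
  interpret simple_finitary_semimatroid M by fact
  obtain \<phi> where "flat_labelled_poset L M \<phi>"
    using poset_isomorphic_flats_iff[OF assms(1) finitary_semimatroid_axioms] assms(3) by blast
  then interpret flat_labelled_poset L M \<phi> .
  have cl0: "cl M {} = {}" by (auto simp: cl_def rank_empty rank_singleton)
  have cl1: "cl M {e} = {e}" if "e \<in> ground M" for e
  proof
    show "cl M {e} \<subseteq> {e}"
    proof
      fix x assume "x \<in> cl M {e}"
      then have "{e, x} \<in> central M" "rk M {e, x} = 1" using rank_singleton[OF that] by (auto simp: cl_def insert_commute)
      then show "x \<in> {e}" using rank_pair[of e x] by force
    qed
  qed (use subset_cl central_singleton that in auto)
  define \<eta> where "\<eta> e = (SOME x. x \<in> carrier L \<and> \<phi> x = {e})" for e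
  have \<eta>: "\<eta> e \<in> carrier L \<and> \<phi> (\<eta> e) = {e}" if "e \<in> ground M" for e
    unfolding \<eta>_def using flat_has_label[OF cl_flat[OF central_singleton[OF that]]] cl1[OF that]
    by (intro someI_ex[of "\<lambda>x. x \<in> carrier L \<and> \<phi> x = {e}"]) auto
  have le_iff: "\<eta> e \<sqsubseteq>\<^bsub>L\<^esub> u \<longleftrightarrow> e \<in> \<phi> u" if "e \<in> ground M" "u \<in> carrier L" for e u
    using label_subset_iff[of "\<eta> e" u] \<eta>[OF that(1)] that(2) by simp
  have bij: "bij_betw \<eta> (ground M) (atoms L)"
  proof (rule bij_betw_imageI)
    show "inj_on \<eta> (ground M)" using \<eta> by (intro inj_onI) (metis singleton_inject)
    show "\<eta> ` ground M = atoms L"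
    proof
      obtain z where z: "least L z (carrier L)" "\<phi> z = {}" using bottom_exists cl0 by auto
      show "\<eta> ` ground M \<subseteq> atoms L"
      proof
        fix a assume "a \<in> \<eta> ` ground M"
        then obtain e where e: "e \<in> ground M" "a = \<eta> e" by auto
        have a: "a \<in> carrier L" "\<phi> a = {e}" using \<eta>[OF e(1)] e(2) by auto
        have zc: "z \<in> carrier L" using z by auto
        obtain b where b: "covers L b z" "b \<sqsubseteq>\<^bsub>L\<^esub> a" "\<phi> b = cl M (\<phi> z \<union> {e})"
          using cover_by_element[OF zc a(1), of e] z a by (auto simp: least_def)
        have "b = a" using b a z(2) cl1[OF e(1)] by (intro label_inj) (auto simp: covers_iff)
        then show "a \<in> atoms L" using b(1) z(1) by (auto simp: atoms_def)
      qed
      show "atoms L \<subseteq> \<eta> ` ground M"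
      proof
        fix a assume a: "a \<in> atoms L"
        then obtain e where e: "\<phi> a = cl M {e}" "{e} \<in> central M" using atom_label by blast
        have eg: "e \<in> ground M" using central_ground[OF e(2)] by simp
        have "a = \<eta> e" using a \<eta>[OF eg] e cl1[OF eg] by (intro label_inj) (auto simp: atoms_def covers_iff)
        then show "a \<in> \<eta> ` ground M" using eg by simp
      qed
    qed
  qed
  have central_iff: "\<eta> ` X \<in> central (atom_semimatroid L) \<longleftrightarrow> X \<in> central M" if X: "X \<subseteq> ground M" for X
  proof -
    have at: "\<eta> ` X \<subseteq> atoms L" using X bij by (auto simp: bij_betw_def)
    have "(\<exists>u\<in>carrier L. X \<subseteq> \<phi> u) \<longleftrightarrow> X \<in> central M"
    proof
      assume "\<exists>u\<in>carrier L. X \<subseteq> \<phi> u"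
      then show "X \<in> central M" using label_central central_subset by blast
    next
      assume "X \<in> central M"
      then show "\<exists>u\<in>carrier L. X \<subseteq> \<phi> u" using flat_has_label[OF cl_flat] subset_cl by metis
    qed
    moreover have "(\<forall>a\<in>\<eta> ` X. a \<sqsubseteq>\<^bsub>L\<^esub> u) \<longleftrightarrow> X \<subseteq> \<phi> u" if "u \<in> carrier L" for u
      using le_iff[OF _ that] X by blast
    ultimately show ?thesis using at by (simp add: central_atom_semimatroid_iff)
  qed
  have "bij_betw (\<lambda>X. \<eta> ` X) (central M) (central (atom_semimatroid L))"
  proof (rule bij_betw_imageI)
    show "inj_on (\<lambda>X. \<eta> ` X) (central M)"
      using bij central_ground by (intro inj_onI) (metis bij_betw_def inj_on_image_eq_iff)
    show "(\<lambda>X. \<eta> ` X) ` central M = central (atom_semimatroid L)"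
    proof
      show "(\<lambda>X. \<eta> ` X) ` central M \<subseteq> central (atom_semimatroid L)"
        using central_iff central_ground by blast
      show "central (atom_semimatroid L) \<subseteq> (\<lambda>X. \<eta> ` X) ` central M"
      proof
        fix Y assume Y: "Y \<in> central (atom_semimatroid L)"
        then have "Y \<subseteq> \<eta> ` ground M" using bij central_atoms[OF Y] by (simp add: bij_betw_def)
        then obtain X where "X \<subseteq> ground M" "Y = \<eta> ` X" by (auto simp: subset_image_iff)
        then show "Y \<in> (\<lambda>X. \<eta> ` X) ` central M" using central_iff Y by blast
      qed
    qed
  qed
  moreover have "poset_rank L (\<Squnion>\<^bsub>L\<^esub>(\<eta> ` X)) = rk M X" if X: "X \<in> central M" for X
  proof -
    obtain s where s: "s \<in> carrier L" "\<phi> s = cl M X" using flat_has_label[OF cl_flat[OF X]] by auto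
    have "is_lub L s (\<eta> ` X)"
    proof (rule is_lub_label[OF _ X s])
      show "\<eta> ` X \<subseteq> carrier L" using \<eta> central_ground[OF X] by auto
      show "X \<subseteq> F \<longleftrightarrow> (\<forall>a\<in>\<eta> ` X. \<phi> a \<subseteq> F)" for F using \<eta> central_ground[OF X] by (auto simp: subset_eq)
    qed
    then show ?thesis using sup_eqI poset_rank_label[OF s(1)] s(2) rank_cl[OF X] by simp
  qed
  ultimately show ?thesis using bij unfolding semimatroid_isomorphic_def by auto
qed

lemma semimatroid_isomorphic_sym:
  assumes "finitary_semimatroid M" "semimatroid_isomorphic M M'"
  shows "semimatroid_isomorphic M' M"
proof -
  interpret finitary_semimatroid M by fact
  obtain f where f: "bij_betw f (ground M) (ground M')" "bij_betw (\<lambda>X. f ` X) (central M) (central M')"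
    "\<And>X. X \<in> central M \<Longrightarrow> rk M' (f ` X) = rk M X"
    using assms(2) by (auto simp: semimatroid_isomorphic_def)
  let ?g = "inv_into (ground M) f"
  have inv: "?g ` (f ` X) = X" if "X \<in> central M" for X
    using inv_into_image_cancel[OF bij_betw_imp_inj_on[OF f(1)] central_ground[OF that]] .
  have im: "(\<lambda>X. f ` X) ` central M = central M'" using f(2) by (simp add: bij_betw_def)
  let ?G = "inv_into (central M) (\<lambda>X. f ` X)"
  have "?G Y = ?g ` Y" if Y: "Y \<in> central M'" for Y
  proof -
    obtain X where X: "X \<in> central M" "Y = f ` X" using Y im by blast
    show ?thesis
      unfolding X(2) inv[OF X(1)] by (rule inv_into_f_f[OF bij_betw_imp_inj_on[OF f(2)] X(1)])
  qed
  then have "bij_betw (\<lambda>Y. ?g ` Y) (central M') (central M)"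
    using bij_betw_inv_into[OF f(2)] bij_betw_cong[of "central M'" ?G "\<lambda>Y. ?g ` Y"] by blast
  moreover have "rk M (?g ` Y) = rk M' Y" if "Y \<in> central M'" for Y
    using that inv f(3) unfolding im[symmetric] by auto
  ultimately show ?thesis
    using bij_betw_inv_into[OF f(1)] unfolding semimatroid_isomorphic_def by blast
qed

lemma semimatroid_isomorphic_trans:
  assumes "semimatroid_isomorphic M M'" "semimatroid_isomorphic M' M''"
  shows "semimatroid_isomorphic M M''"
proof -
  obtain f where f: "bij_betw f (ground M) (ground M')" "bij_betw (\<lambda>X. f ` X) (central M) (central M')"
    "\<And>X. X \<in> central M \<Longrightarrow> rk M' (f ` X) = rk M X"
    using assms(1) by (auto simp: semimatroid_isomorphic_def)
  obtain g where g: "bij_betw g (ground M') (ground M'')" "bij_betw (\<lambda>X. g ` X) (central M') (central M'')"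
    "\<And>X. X \<in> central M' \<Longrightarrow> rk M'' (g ` X) = rk M' X"
    using assms(2) by (auto simp: semimatroid_isomorphic_def)
  have eq: "(\<lambda>X. (g \<circ> f) ` X) = (\<lambda>X. g ` X) \<circ> (\<lambda>X. f ` X)" by (auto simp: image_comp)
  have "bij_betw (\<lambda>X. (g \<circ> f) ` X) (central M) (central M'')"
    unfolding eq by (rule bij_betw_trans[OF f(2) g(2)])
  moreover have "rk M'' ((g \<circ> f) ` X) = rk M X" if "X \<in> central M" for X
    using g(3)[of "f ` X"] f(3)[OF that] bij_betwE[OF f(2)] that by (simp add: image_comp)
  ultimately show ?thesis
    using bij_betw_trans[OF f(1) g(1)] unfolding semimatroid_isomorphic_def by blast
qed

section \<open>Geometric semilattices correspond to simple semimatroids\<close>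

theorem poset_of_flats_geometric:
  assumes "partial_order L" "finitary_semimatroid M" "poset_isomorphic L (poset_of_flats M)"
  shows "finitary_geometric_semilattice L"
  using assms poset_isomorphic_flats_iff flat_labelled_poset.is_finitary_geometric_semilattice by blast

theorem poset_of_flats_atom_semimatroid:
  assumes "finitary_geometric_semilattice L"
  shows "poset_isomorphic L (poset_of_flats (atom_semimatroid L))"
proof -
  interpret finitary_geometric_semilattice L by fact
  interpret M: simple_finitary_semimatroid "atom_semimatroid L" by (rule simple_atom_semimatroid)
  show ?thesis
    using atom_labelling
    by (subst poset_isomorphic_flats_iff[OF partial_order_axioms M.finitary_semimatroid_axioms]) (rule exI)
qed

theorem simple_semimatroid_unique:
  assumes L: "partial_order L"
    and M1: "simple_finitary_semimatroid M1" "poset_isomorphic L (poset_of_flats M1)"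
    and M2: "simple_finitary_semimatroid M2" "poset_isomorphic L (poset_of_flats M2)"
  shows "semimatroid_isomorphic M1 M2"
proof -
  have iso: "semimatroid_isomorphic M1 (atom_semimatroid L)" "semimatroid_isomorphic M2 (atom_semimatroid L)"
    using simple_isomorphic_atom_semimatroid[OF L] M1 M2 by blast+
  have "finitary_semimatroid M2" using M2(1) by (rule simple_finitary_semimatroid.axioms(1))
  then show ?thesis using iso semimatroid_isomorphic_sym semimatroid_isomorphic_trans by blast
qed

theorem theorem5:
  fixes L :: "'a gorder"
  assumes "partial_order L"
  shows "(finitary_geometric_semilattice L \<longleftrightarrow>
            (\<exists>M :: 'a semimatroid. finitary_semimatroid M \<and> poset_isomorphic L (poset_of_flats M)))
       \<and> (\<forall>M :: 'b semimatroid. finitary_semimatroid M \<and> poset_isomorphic L (poset_of_flats M)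
            \<longrightarrow> finitary_geometric_semilattice L)
       \<and> (finitary_geometric_semilattice L \<longrightarrow>
            (\<exists>M :: 'a semimatroid. simple_finitary_semimatroid M \<and>
               poset_isomorphic L (poset_of_flats M)) \<and>
            (\<forall>(M1 :: 'b semimatroid) (M2 :: 'c semimatroid).
               simple_finitary_semimatroid M1 \<and> poset_isomorphic L (poset_of_flats M1) \<and>
               simple_finitary_semimatroid M2 \<and> poset_isomorphic L (poset_of_flats M2)
               \<longrightarrow> semimatroid_isomorphic M1 M2))"
proof (intro conjI impI allI iffI)
  assume "finitary_geometric_semilattice L"
  then interpret finitary_geometric_semilattice L .
  show ex: "\<exists>M :: 'a semimatroid. simple_finitary_semimatroid M \<and> poset_isomorphic L (poset_of_flats M)"
    using simple_atom_semimatroid poset_of_flats_atom_semimatroid finitary_geometric_semilattice_axioms by blast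
  then show "\<exists>M :: 'a semimatroid. finitary_semimatroid M \<and> poset_isomorphic L (poset_of_flats M)"
    using simple_finitary_semimatroid.axioms(1) by blast
qed (use assms poset_of_flats_geometric simple_semimatroid_unique in blast)+

end
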